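(* Suppose we have an algorithm which takes as input a sequence of (formal) cells $\sigma_1,\dots,\sigma_n$ and their boundaries $\partial\sigma_1,\dots,\partial\sigma_n$ and produces as output the persistent relative homology of $\sigma_1\cup\dots\cup\sigma_n$, i.e. the persistence module $\mathrm{H}(C_n/\mathbb{C},\partial)$. Let $\mathbb{X}=\sigma_1\cup\dots\cup\sigma_n$ be a filtered cell complex, and let $\tau_i=\sigma^*_{n+1-i}$, $1\le i\le n$. Then the same algorithm applied to the sequence of formal cells $\tau_1,\dots,\tau_n$ and coboundaries $\delta\tau_1,\dots,\delta\tau_n$ computes the persistent absolute cohomology $\mathrm{H}^*(\mathbb{X})$ of $\mathbb{X}$ (up to reversing the indexing, index $i$ of the output corresponding to index $n-i$ of $\mathrm{H}^*(\mathbb{X})$).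
   Context: Fix a field $\mathbf{k}$ of coefficients. A filtered cell complex $\mathbb{X}: X_1\subset\dots\subset X_n=X_\infty$ starts with a vertex $X_1=\sigma_1$ and satisfies $X_i=X_{i-1}\cup\sigma_i$ with a single cell $\sigma_i$ added at each step. The homological grading is suppressed (total homology is meant). Input data: a sequence of formal cells $\sigma_1,\dots,\sigma_n$ with boundaries is a basis $\sigma_1,\dots,\sigma_n$ of a $\mathbf{k}$-vector space $C_n$ together with $\partial\sigma_j=\sum_{i<j}D_{ij}\sigma_i$ such that $\partial^2=0$; equivalently a strictly upper-triangular matrix $D$ over $\mathbf{k}$ with $D^2=0$. A filtered cell complex gives such data via its cellular boundary map. Set $C_i=\langle\sigma_1,\dots,\sigma_i\rangle$. The persistent relative homology is the persistence module (sequence of vector spaces and linear maps, considered up to isomorphism) $\mathrm{H}(C_n/\mathbb{C},\partial)$ obtained by taking the homology, with respect to the maps induced by $\partial$, of $$C_n/\mathbb{C}:\ C_n\to C_n/C_1\to C_n/C_2\to\dots\to C_n/C_{n-1},$$ indexed by $0,\dots,n-1$. Dual data: $\sigma_1^*,\dots,\sigma_n^*$ is the basis of $C_n^*=\mathrm{Hom}(C_n,\mathbf{k})$ dual to $\sigma_1,\dots,\sigma_n$, and $\delta=\partial^*$ is the adjoint of $\partial$. With $\tau_i=\sigma^*_{n+1-i}$ one has $\delta\tau_j=\sum_{i<j}D^\perp_{ij}\tau_i$ with $D^\perp_{ij}=D_{n+1-j,\,n+1-i}$. The persistent absolute cohomology $\mathrm{H}^*(\mathbb{X})$ is the homology, with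 respect to the coboundaries adjoint to $\partial|_{C_i}$, of $\mathbb{C}^*: C_1^*\leftarrow C_2^*\leftarrow\dots\leftarrow C_n^*$ (restriction maps), indexed by $1,\dots,n$; that is, $\mathrm{H}^*(X_1)\leftarrow\dots\leftarrow \mathrm{H}^*(X_n)$. Index transcription: an interval $[p,q-1]$ of the output for $\tau_i,\delta\tau_i$ is read as the interval $[n+1-q,n-p]$ of $\mathrm{H}^*(\mathbb{X})$. *)

theory Defs
  imports "HOL-Algebra.AbelCoset" "Jordan_Normal_Form.Missing_VectorSpace"
begin

section \<open>Quotients, homology and duals of vector spaces\<close>

text \<open>The fields \<open>mult\<close> and \<open>one\<close>, which the record type of modules inherits from rings,
  are never used. The summand \<open>W\<close> in the scalar multiplication matters only for \<open>c = \<zero>\<close>,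
  where the elementwise multiple of a coset is \<open>{\<zero>}\<close> instead of \<open>W\<close>.\<close>

definition quotient_space ::
    "('k, 'v, 'm) module_scheme \<Rightarrow> 'v set \<Rightarrow> ('k, 'v set) module" where
  "quotient_space V W =
    \<lparr>carrier = a_rcosets\<^bsub>V\<^esub> W, mult = (\<lambda>A B. W), one = W, zero = W,
     add = (\<lambda>A B. A <+>\<^bsub>V\<^esub> B), smult = (\<lambda>c A. W <+>\<^bsub>V\<^esub> ((\<lambda>x. c \<odot>\<^bsub>V\<^esub> x) ` A))\<rparr>"

text \<open>The map induced by \<open>f\<close> into the quotient of \<open>V'\<close> by \<open>W'\<close>: the coset \<open>W + x\<close> is sent
  to \<open>W' + f x\<close>, provided that \<open>f\<close> is linear and maps \<open>W\<close> into \<open>W'\<close>.\<close>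

definition quotient_map ::
    "('k, 'w, 'm) module_scheme \<Rightarrow> 'w set \<Rightarrow> ('v \<Rightarrow> 'w) \<Rightarrow> 'v set \<Rightarrow> 'w set" where
  "quotient_map V' W' f A = W' <+>\<^bsub>V'\<^esub> (f ` A)"

text \<open>Total homology \<open>ker d / im d\<close> of a vector space with an endomorphism of square zero.\<close>

definition homology ::
    "('k, 'v, 'm) module_scheme \<Rightarrow> ('v \<Rightarrow> 'v) \<Rightarrow> ('k, 'v set) module" where
  "homology V d = quotient_space (V\<lparr>carrier := mod_hom.ker V V d\<rparr>) (mod_hom.im V d)"

definition homology_map ::
    "('k, 'w, 'm) module_scheme \<Rightarrow> ('w \<Rightarrow> 'w) \<Rightarrow> ('v \<Rightarrow> 'w) \<Rightarrow> 'v set \<Rightarrow> 'w set" where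
  "homology_map V' d' f = quotient_map V' (mod_hom.im V' d') f"

definition base_field :: "('k, 'r) ring_scheme \<Rightarrow> ('k, 'k) module" where
  "base_field K = \<lparr>carrier = carrier K, mult = mult K, one = one K, zero = zero K,
     add = add K, smult = mult K\<rparr>"

text \<open>\<open>Hom(V, K)\<close>; functionals are made extensional so that each is a single HOL function.\<close>

definition dual_space ::
    "('k, 'r) ring_scheme \<Rightarrow> ('k, 'v, 'm) module_scheme \<Rightarrow> ('k, 'v \<Rightarrow> 'k) module" where
  "dual_space K V = (ring.func_space K (carrier V))
     \<lparr>carrier := module_hom K V (base_field K) \<inter> extensional (carrier V)\<rparr>"

definition adjoint ::
    "('k, 'v, 'm) module_scheme \<Rightarrow> ('v \<Rightarrow> 'w) \<Rightarrow> ('w \<Rightarrow> 'k) \<Rightarrow> 'v \<Rightarrow> 'k" where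
  "adjoint V f \<phi> = compose (carrier V) \<phi> f"

section \<open>Persistence modules\<close>

text \<open>A sequence of vector spaces with maps between consecutive ones. The map with index \<open>i\<close>
  connects the spaces with indices \<open>i\<close> and \<open>i + 1\<close>; it goes from \<open>i\<close> to \<open>i + 1\<close> for
  homology and from \<open>i + 1\<close> to \<open>i\<close> for cohomology.\<close>

record ('k, 'v) space_sequence =
  pspace :: "nat \<Rightarrow> ('k, 'v) module"
  pmap :: "nat \<Rightarrow> 'v \<Rightarrow> 'v"

text \<open>Persistence modules indexed by \<open>0, \<dots>, m - 1\<close>, with maps in the direction of
  increasing index.\<close>

definition persistence_module ::
    "('k, 'r) ring_scheme \<Rightarrow> nat \<Rightarrow> ('k, 'v) space_sequence \<Rightarrow> bool" where
  "persistence_module K m P \<longleftrightarrow>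
     (\<forall>i<m. vectorspace K (pspace P i)) \<and>
     (\<forall>i. Suc i < m \<longrightarrow> pmap P i \<in> module_hom K (pspace P i) (pspace P (Suc i)))"

definition pmodule_iso ::
    "('k, 'r) ring_scheme \<Rightarrow> nat \<Rightarrow> ('k, 'v) space_sequence \<Rightarrow> ('k, 'w) space_sequence \<Rightarrow> bool"
  where
  "pmodule_iso K m P Q \<longleftrightarrow>
     persistence_module K m P \<and> persistence_module K m Q \<and>
     (\<exists>\<phi>. (\<forall>i<m. \<phi> i \<in> module_hom K (pspace P i) (pspace Q i) \<and>
                bij_betw (\<phi> i) (carrier (pspace P i)) (carrier (pspace Q i))) \<and>
          (\<forall>i. Suc i < m \<longrightarrow>
             (\<forall>x\<in>carrier (pspace P i). \<phi> (Suc i) (pmap P i x) = pmap Q i (\<phi> i x))))"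

text \<open>Turns \<open>M\<^sub>1 \<leftarrow> \<dots> \<leftarrow> M\<^sub>n\<close> into the persistence module with indices \<open>0, \<dots>, n - 1\<close> whose
  space at index \<open>i\<close> is \<open>M\<^sub>n\<^sub>-\<^sub>i\<close>.\<close>

definition reverse_index :: "nat \<Rightarrow> ('k, 'v) space_sequence \<Rightarrow> ('k, 'v) space_sequence" where
  "reverse_index n M = \<lparr>pspace = (\<lambda>i. pspace M (n - i)), pmap = (\<lambda>i. pmap M (n - Suc i))\<rparr>"

section \<open>Formal cells\<close>

text \<open>A sequence of formal cells \<open>\<sigma> 1, \<dots>, \<sigma> n\<close> with boundary map \<open>d\<close>. A filtered cell
  complex enters through its cellular chain space over \<open>K\<close>, whose basis are its cells in the
  order in which they are added, and its cellular boundary map.\<close>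

locale formal_cells =
  fixes K :: "('k, 'r) ring_scheme" and V :: "('k, 'v, 'm) module_scheme"
    and d :: "'v \<Rightarrow> 'v" and n :: nat and \<sigma> :: "nat \<Rightarrow> 'v"
  assumes linear: "linear_map K V V d"
    and nonempty: "1 \<le> n"
    and inj: "inj_on \<sigma> {1..n}"
    and basis: "vectorspace.basis K V (\<sigma> ` {1..n})"
    and boundary: "\<And>j. j \<in> {1..n} \<Longrightarrow> d (\<sigma> j) \<in> module.span K V (\<sigma> ` {1..<j})"
    and square_zero: "\<And>v. v \<in> carrier V \<Longrightarrow> d (d v) = \<zero>\<^bsub>V\<^esub>"

definition filtration ::
    "('k, 'r) ring_scheme \<Rightarrow> ('k, 'v, 'm) module_scheme \<Rightarrow> (nat \<Rightarrow> 'v) \<Rightarrow> nat \<Rightarrow> 'v set" where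
  "filtration K V \<sigma> i = module.span K V (\<sigma> ` {1..i})"

text \<open>The homology of \<open>V \<rightarrow> V/C\<^sub>1 \<rightarrow> V/C\<^sub>2 \<rightarrow> \<dots>\<close>, where \<open>C\<^sub>i\<close> is the \<open>i\<close>-th step of the
  filtration. The space \<open>V\<close> at index 0 is the quotient by \<open>C\<^sub>0 = {\<zero>}\<close>.\<close>

definition persistent_relative_homology ::
    "('k, 'r) ring_scheme \<Rightarrow> ('k, 'v, 'm) module_scheme \<Rightarrow> ('v \<Rightarrow> 'v) \<Rightarrow> (nat \<Rightarrow> 'v) \<Rightarrow>
      ('k, 'v set set) space_sequence" where
  "persistent_relative_homology K V d \<sigma> =
    (let C = filtration K V \<sigma>;
         Q = (\<lambda>i. quotient_space V (C i));
         dQ = (\<lambda>i. quotient_map V (C i) d)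
     in \<lparr>pspace = (\<lambda>i. homology (Q i) (dQ i)),
         pmap = (\<lambda>i. homology_map (Q (Suc i)) (dQ (Suc i)) (quotient_map V (C (Suc i)) id))\<rparr>)"

text \<open>The homology of \<open>C\<^sub>1\<^sup>* \<leftarrow> C\<^sub>2\<^sup>* \<leftarrow> \<dots> \<leftarrow> C\<^sub>n\<^sup>*\<close>. The coboundary of \<open>C\<^sub>i\<^sup>*\<close> is the adjoint of
  the restriction of \<open>d\<close> to \<open>C\<^sub>i\<close>, and the restriction of functionals from \<open>C\<^sub>i\<^sub>+\<^sub>1\<close>
  to \<open>C\<^sub>i\<close> is the adjoint of the inclusion.\<close>

definition persistent_cohomology ::
    "('k, 'r) ring_scheme \<Rightarrow> ('k, 'v, 'm) module_scheme \<Rightarrow> ('v \<Rightarrow> 'v) \<Rightarrow> (nat \<Rightarrow> 'v) \<Rightarrow>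
      ('k, ('v \<Rightarrow> 'k) set) space_sequence" where
  "persistent_cohomology K V d \<sigma> =
    (let C = (\<lambda>i. V\<lparr>carrier := filtration K V \<sigma> i\<rparr>)
     in \<lparr>pspace = (\<lambda>i. homology (dual_space K (C i)) (adjoint (C i) d)),
         pmap = (\<lambda>i. homology_map (dual_space K (C i)) (adjoint (C i) d) (adjoint (C i) id))\<rparr>)"

section \<open>Coordinates and the dual basis\<close>

definition coordinate ::
    "('k, 'r) ring_scheme \<Rightarrow> ('k, 'v, 'm) module_scheme \<Rightarrow> nat \<Rightarrow> (nat \<Rightarrow> 'v) \<Rightarrow>
      nat \<Rightarrow> 'v \<Rightarrow> 'k" where
  "coordinate K V n \<sigma> i v =
    (THE a. a \<in> {1..n} \<rightarrow>\<^sub>E carrier K \<and> v = (\<Oplus>\<^bsub>V\<^esub>j\<in>{1..n}. a j \<odot>\<^bsub>V\<^esub> \<sigma> j)) i"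

definition dual_basis ::
    "('k, 'r) ring_scheme \<Rightarrow> ('k, 'v, 'm) module_scheme \<Rightarrow> nat \<Rightarrow> (nat \<Rightarrow> 'v) \<Rightarrow>
      nat \<Rightarrow> 'v \<Rightarrow> 'k" where
  "dual_basis K V n \<sigma> i = restrict (coordinate K V n \<sigma> i) (carrier V)"

text \<open>The coefficients \<open>D i j\<close> in \<open>d (\<sigma> j) = (\<Sum>i<j. D i j \<sigma> i)\<close>.\<close>

definition boundary_coeffs ::
    "('k, 'r) ring_scheme \<Rightarrow> ('k, 'v, 'm) module_scheme \<Rightarrow> ('v \<Rightarrow> 'v) \<Rightarrow> nat \<Rightarrow>
      (nat \<Rightarrow> 'v) \<Rightarrow> nat \<Rightarrow> nat \<Rightarrow> 'k" where
  "boundary_coeffs K V d n \<sigma> i j = coordinate K V n \<sigma> i (d (\<sigma> j))"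

section \<open>Algorithms computing persistent relative homology\<close>

text \<open>The input of an algorithm is the number \<open>n\<close> of cells and the coefficients \<open>D i j\<close>,
  \<open>1 \<le> i, j \<le> n\<close>, of their boundaries. The formal cells themselves are then the standard basis
  of \<open>K\<^sup>n\<close>.\<close>

definition boundary_matrix :: "('k, 'r) ring_scheme \<Rightarrow> nat \<Rightarrow> (nat \<Rightarrow> nat \<Rightarrow> 'k) \<Rightarrow> bool" where
  "boundary_matrix K n D \<longleftrightarrow>
     (\<forall>i\<in>{1..n}. \<forall>j\<in>{1..n}. D i j \<in> carrier K) \<and>
     (\<forall>i\<in>{1..n}. \<forall>j\<in>{1..n}. j \<le> i \<longrightarrow> D i j = \<zero>\<^bsub>K\<^esub>) \<and>
     (\<forall>i\<in>{1..n}. \<forall>j\<in>{1..n}. (\<Oplus>\<^bsub>K\<^esub>k\<in>{1..n}. D i k \<otimes>\<^bsub>K\<^esub> D k j) = \<zero>\<^bsub>K\<^esub>)"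

definition standard_cell :: "('k, 'r) ring_scheme \<Rightarrow> nat \<Rightarrow> nat \<Rightarrow> nat \<Rightarrow> 'k" where
  "standard_cell K n j = (\<lambda>i\<in>{1..n}. if i = j then \<one>\<^bsub>K\<^esub> else \<zero>\<^bsub>K\<^esub>)"

definition matrix_map ::
    "('k, 'r) ring_scheme \<Rightarrow> nat \<Rightarrow> (nat \<Rightarrow> nat \<Rightarrow> 'k) \<Rightarrow> (nat \<Rightarrow> 'k) \<Rightarrow> nat \<Rightarrow> 'k" where
  "matrix_map K n D x = (\<lambda>i\<in>{1..n}. \<Oplus>\<^bsub>K\<^esub>j\<in>{1..n}. D i j \<otimes>\<^bsub>K\<^esub> x j)"

text \<open>The output of an algorithm is a persistence module, realised on an arbitrary type and
  required only up to isomorphism.\<close>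

definition computes_relative_homology ::
    "('k, 'r) ring_scheme \<Rightarrow>
      (nat \<Rightarrow> (nat \<Rightarrow> nat \<Rightarrow> 'k) \<Rightarrow> ('k, 'o) space_sequence) \<Rightarrow> bool" where
  "computes_relative_homology K alg \<longleftrightarrow>
     (\<forall>n D. 1 \<le> n \<and> boundary_matrix K n D \<longrightarrow>
        pmodule_iso K n (alg n D)
          (persistent_relative_homology K (ring.func_space K {1..n})
            (matrix_map K n D) (standard_cell K n)))"

end

theory Submission
  imports Defs
begin

text \<open>Sending \<open>x\<close> to \<open>\<Sum>\<^sub>j x\<^sub>j \<tau>\<^sub>j\<close> identifies \<open>K\<^sup>n\<close>, with the matrix of \<open>\<delta>\<close> in the basis \<open>\<tau>\<close>, with the
  cochain complex of the whole cell complex. Restricting functionals to the \<open>(n - i)\<close>-th step of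
  the filtration gives a surjective chain map onto the cochains of that step. Its kernel consists
  of the functionals that vanish on the first \<open>n - i\<close> cells, that is, of the span of
  \<open>\<tau> 1, \<dots>, \<tau> i\<close>. So the quotient complexes that the algorithm works with on the dual input are
  the cochain complexes of the steps in reversed order, compatibly with the maps between them, and
  it remains to pass to homology.\<close>

section \<open>Quotient spaces and induced maps\<close>

text \<open>The guarantee on the algorithm speaks only about matrices, hence only about
  \<open>K\<^sup>n\<close> with its standard cells. Cochains therefore enter through coordinates,
  and the dual matrix must first be shown strictly upper triangular with square zero. This forces
  the reversed order: a cell occurs only in boundaries of later cells, so the coboundary of its dual
  functional involves only the duals of later cells, and those have to come first. Elements of
  quotients and of homology are sets, and a map on them is understood only through representatives.
  To avoid repeating well-definedness arguments, maps between complexes are obtained by factoring: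
  if a chain map equals \<open>h\<close> after a surjective chain map, then \<open>h\<close> is a
  chain map too. This one principle serves the projections between quotients, the map from the
  quotient by a kernel, and the restriction of cochains. Isomorphic spaces at each index would not
  be enough; the squares formed with the maps of the two sequences must commute, which is checked on
  representatives before passing to homology.\<close>

lemma linear_mapI:
  assumes "vectorspace K V" and "vectorspace K W" and "f \<in> module_hom K V W"
  shows "linear_map K V W f"
  using assms unfolding linear_map_def mod_hom_def mod_hom_axioms_def vectorspace_def by blast

lemma module_homI:
  assumes "\<And>x. x \<in> carrier V \<Longrightarrow> f x \<in> carrier W"
    and "\<And>x y. x \<in> carrier V \<Longrightarrow> y \<in> carrier V \<Longrightarrow> f (x \<oplus>\<^bsub>V\<^esub> y) = f x \<oplus>\<^bsub>W\<^esub> f y"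
    and "\<And>c x. c \<in> carrier K \<Longrightarrow> x \<in> carrier V \<Longrightarrow> f (c \<odot>\<^bsub>V\<^esub> x) = c \<odot>\<^bsub>W\<^esub> f x"
  shows "f \<in> module_hom K V W"
  using assms unfolding module_hom_def by auto

lemma module_hom_comp:
  assumes "f \<in> module_hom K U V" and "g \<in> module_hom K V W"
  shows "g \<circ> f \<in> module_hom K U W"
  using assms unfolding module_hom_def by (auto simp: Pi_iff)

text \<open>Meant for extensional functionals, which agree with a linear formula only on the
  carrier.\<close>

lemma module_hom_cong:
  assumes "vectorspace K V" and "f \<in> module_hom K V W"
    and "\<And>x. x \<in> carrier V \<Longrightarrow> g x = f x"
  shows "g \<in> module_hom K V W"
proof -
  interpret vectorspace K V by fact
  show ?thesis
    using assms(2,3) unfolding module_hom_def by auto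
qed

lemma linear_map_comp:
  assumes "linear_map K U V f" and "linear_map K V W g"
  shows "linear_map K U W (g \<circ> f)"
proof -
  interpret f: linear_map K U V f by fact
  interpret g: linear_map K V W g by fact
  show ?thesis
    by (intro linear_mapI module_hom_comp[OF f.f_hom g.f_hom] f.V.vectorspace_axioms
        g.W.vectorspace_axioms)
qed

text \<open>The equalizer of two linear maps is a subspace.\<close>

lemma linear_map_eq_on_span:
  assumes "linear_map K V W f" and "linear_map K V W g" and "S \<subseteq> carrier V"
    and "\<And>s. s \<in> S \<Longrightarrow> f s = g s" and "v \<in> module.span K V S"
  shows "f v = g v"
proof -
  interpret f: linear_map K V W f by fact
  interpret g: linear_map K V W g by fact
  have "submodule K {v \<in> carrier V. f v = g v} V"
    by unfold_locales auto
  with assms have "module.span K V S \<subseteq> {v \<in> carrier V. f v = g v}"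
    by (intro f.V.module.span_is_subset) auto
  with assms(5) show ?thesis
    by blast
qed

context vectorspace
begin

lemma subspace_abelian_subgroup:
  assumes "subspace K W V"
  shows "abelian_subgroup W V"
proof (rule abelian_subgroupI3)
  interpret W: submodule K W V
    using assms by simp
  show "additive_subgroup W V"
  proof (intro additive_subgroupI add.subgroupI)
    show "\<ominus>\<^bsub>V\<^esub> a \<in> W" if "a \<in> W" for a
      using that W.subset W.smult_closed[of "\<ominus>\<^bsub>K\<^esub> \<one>\<^bsub>K\<^esub>" a] by (simp add: smult_minus_1 subset_iff)
  qed (use W.subset in \<open>auto intro: W.zero_closed\<close>)
qed (fact M.abelian_group_axioms)

text \<open>Homology is a quotient of the cycles, so the boundaries are needed as a subspace of that
  smaller space and not only of \<open>V\<close>.\<close>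

lemma subspace_vs_subset:
  assumes "subspace K W V" and "subspace K U V" and "W \<subseteq> U"
  shows "subspace K W (V\<lparr>carrier := U\<rparr>)"
proof -
  have "vectorspace K (V\<lparr>carrier := U\<rparr>)"
    using assms subspace_is_vs by blast
  then show ?thesis
    using assms by (auto simp: subspace_def submodule_def vectorspace_def)
qed

lemma coset_eq_iff:
  assumes "subspace K W V" and "x \<in> carrier V" and "y \<in> carrier V"
  shows "W +>\<^bsub>V\<^esub> x = W +>\<^bsub>V\<^esub> y \<longleftrightarrow> x \<ominus>\<^bsub>V\<^esub> y \<in> W"
proof -
  interpret W: abelian_subgroup W V
    using assms subspace_abelian_subgroup by blast
  show ?thesis
    using assms W.a_rcos_module[of y x] W.a_repr_independence'[of x y] W.a_rcos_self[of x]
    by (auto simp: a_minus_def)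
qed

text \<open>Scalar multiples of cosets and induced maps are both defined as \<open>W\<close> plus an
  image. When all members of the image are congruent modulo \<open>W\<close>, the sum collapses to a
  single coset, and any \<open>x\<close> in \<open>A\<close> represents it.\<close>

lemma set_add_image_coset:
  assumes "subspace K W V" and "x \<in> A" and "g ` A \<subseteq> carrier V"
    and "\<And>y. y \<in> A \<Longrightarrow> g y \<ominus>\<^bsub>V\<^esub> g x \<in> W"
  shows "W <+>\<^bsub>V\<^esub> (g ` A) = W +>\<^bsub>V\<^esub> g x"
proof -
  interpret W: abelian_subgroup W V
    using assms subspace_abelian_subgroup by blast
  have "W +>\<^bsub>V\<^esub> g y = W +>\<^bsub>V\<^esub> g x" if "y \<in> A" for y
    using assms that by (subst coset_eq_iff) auto
  then have "(\<Union>y\<in>A. W +>\<^bsub>V\<^esub> g y) = W +>\<^bsub>V\<^esub> g x"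
    using assms(2) by (subst SUP_eq_const[where x = "W +>\<^bsub>V\<^esub> g x"]) blast+
  moreover have "W <+>\<^bsub>V\<^esub> (g ` A) = (\<Union>y\<in>A. W +>\<^bsub>V\<^esub> g y)"
    unfolding set_add_def' a_r_coset_def' by blast
  ultimately show ?thesis
    by simp
qed

lemma carrier_quotient_space:
  "carrier (quotient_space V W) = (\<lambda>x. W +>\<^bsub>V\<^esub> x) ` carrier V"
  by (simp add: quotient_space_def A_RCOSETS_def' UNION_singleton_eq_range)

lemma zero_quotient_space:
  assumes "subspace K W V"
  shows "\<zero>\<^bsub>quotient_space V W\<^esub> = W +>\<^bsub>V\<^esub> \<zero>\<^bsub>V\<^esub>"
  using assms submodule.subset[OF is_module] by (simp add: quotient_space_def)

lemma add_quotient_space: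
  assumes "subspace K W V" and "x \<in> carrier V" and "y \<in> carrier V"
  shows "(W +>\<^bsub>V\<^esub> x) \<oplus>\<^bsub>quotient_space V W\<^esub> (W +>\<^bsub>V\<^esub> y) = W +>\<^bsub>V\<^esub> (x \<oplus>\<^bsub>V\<^esub> y)"
proof -
  interpret W: abelian_subgroup W V
    using assms subspace_abelian_subgroup by blast
  show ?thesis
    using assms by (simp add: quotient_space_def W.a_rcos_sum)
qed

lemma smult_quotient_space:
  assumes "subspace K W V" and "c \<in> carrier K" and "x \<in> carrier V"
  shows "c \<odot>\<^bsub>quotient_space V W\<^esub> (W +>\<^bsub>V\<^esub> x) = W +>\<^bsub>V\<^esub> (c \<odot>\<^bsub>V\<^esub> x)"
proof -
  interpret W: abelian_subgroup W V
    using assms subspace_abelian_subgroup by blast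
  interpret W': submodule K W V
    using assms by simp
  have "c \<odot>\<^bsub>V\<^esub> y \<ominus>\<^bsub>V\<^esub> c \<odot>\<^bsub>V\<^esub> x \<in> W" if "y \<in> W +>\<^bsub>V\<^esub> x" for y
  proof -
    have y: "y \<in> carrier V"
      using that assms W.a_elemrcos_carrier by blast
    have "y \<ominus>\<^bsub>V\<^esub> x \<in> W"
      using that assms W.a_rcos_module_imp by (auto simp: a_minus_def)
    then have "c \<odot>\<^bsub>V\<^esub> (y \<ominus>\<^bsub>V\<^esub> x) \<in> W"
      using assms by simp
    then show ?thesis
      using assms y by (simp add: a_minus_def smult_r_distr smult_r_minus)
  qed
  then have "W <+>\<^bsub>V\<^esub> ((\<lambda>y. c \<odot>\<^bsub>V\<^esub> y) ` (W +>\<^bsub>V\<^esub> x)) = W +>\<^bsub>V\<^esub> (c \<odot>\<^bsub>V\<^esub> x)"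
    using assms W.a_elemrcos_carrier by (intro set_add_image_coset) (auto simp: W.a_rcos_self)
  then show ?thesis
    by (simp add: quotient_space_def)
qed

lemma quotient_space_is_vs:
  assumes W: "subspace K W V"
  shows "vectorspace K (quotient_space V W)"
proof -
  note simps = carrier_quotient_space zero_quotient_space[OF W] add_quotient_space[OF W]
    smult_quotient_space[OF W]
  have inverse: "\<exists>w\<in>carrier (quotient_space V W). v \<oplus>\<^bsub>quotient_space V W\<^esub> w = \<zero>\<^bsub>quotient_space V W\<^esub>"
    if "v \<in> carrier (quotient_space V W)" for v
  proof -
    from that obtain x where x: "x \<in> carrier V" "v = W +>\<^bsub>V\<^esub> x"
      by (auto simp: simps)
    then show ?thesis
      by (intro bexI[of _ "W +>\<^bsub>V\<^esub> (\<ominus>\<^bsub>V\<^esub> x)"]) (auto simp: simps M.r_neg)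
  qed
  show ?thesis
    by (rule vs_criteria)
      (use inverse field_axioms in \<open>auto simp: simps M.a_ac smult_l_distr smult_r_distr smult_assoc1\<close>)
qed

end

section \<open>Induced maps on quotients and the first isomorphism theorem\<close>

lemma quotient_map_coset:
  assumes "linear_map K V V' f" and "subspace K W V" and "subspace K W' V'"
    and "f ` W \<subseteq> W'" and "x \<in> carrier V"
  shows "quotient_map V' W' f (W +>\<^bsub>V\<^esub> x) = W' +>\<^bsub>V'\<^esub> f x"
proof -
  interpret linear_map K V V' f by fact
  interpret U: abelian_subgroup W V
    using assms V.subspace_abelian_subgroup by blast
  have "f y \<ominus>\<^bsub>V'\<^esub> f x \<in> W'" if "y \<in> W +>\<^bsub>V\<^esub> x" for y
  proof -
    have y: "y \<in> carrier V"
      using that assms U.a_elemrcos_carrier by blast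
    have "y \<ominus>\<^bsub>V\<^esub> x \<in> W"
      using that assms U.a_rcos_module_imp by (auto simp: a_minus_def)
    then have "f (y \<ominus>\<^bsub>V\<^esub> x) \<in> W'"
      using assms by blast
    then show ?thesis
      using assms y by simp
  qed
  then show ?thesis
    unfolding quotient_map_def
    using assms U.a_elemrcos_carrier by (intro W.set_add_image_coset) (auto simp: U.a_rcos_self)
qed

lemma quotient_map_linear:
  assumes "linear_map K V V' f" and "subspace K W V" and "subspace K W' V'" and "f ` W \<subseteq> W'"
  shows "linear_map K (quotient_space V W) (quotient_space V' W') (quotient_map V' W' f)"
proof -
  interpret linear_map K V V' f by fact
  note [simp] = quotient_map_coset[OF assms] V.carrier_quotient_space W.carrier_quotient_space
    V.add_quotient_space[OF assms(2)] W.add_quotient_space[OF assms(3)]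
    V.smult_quotient_space[OF assms(2)] W.smult_quotient_space[OF assms(3)]
  show ?thesis
    by (intro linear_mapI V.quotient_space_is_vs W.quotient_space_is_vs assms module_homI) auto
qed

text \<open>\<open>f ` A\<close> is a singleton if \<open>A\<close> is a coset of the kernel of \<open>f\<close>.\<close>

definition kernel_quotient_map :: "('v \<Rightarrow> 'w) \<Rightarrow> 'v set \<Rightarrow> 'w" where
  "kernel_quotient_map f A = the_elem (f ` A)"

lemma kernel_quotient_map_coset:
  assumes "linear_map K V W f" and "x \<in> carrier V"
  shows "kernel_quotient_map f (mod_hom.ker V W f +>\<^bsub>V\<^esub> x) = f x"
proof -
  interpret linear_map K V W f by fact
  interpret U: abelian_subgroup ker V
    by (rule V.subspace_abelian_subgroup[OF kerT_is_subspace])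
  have "f y = f x" if "y \<in> ker +>\<^bsub>V\<^esub> x" for y
  proof -
    have y: "y \<in> carrier V"
      using that assms(2) U.a_elemrcos_carrier by blast
    have "y \<ominus>\<^bsub>V\<^esub> x \<in> ker"
      using that assms(2) U.a_rcos_module_imp unfolding a_minus_def by blast
    then have "f (y \<ominus>\<^bsub>V\<^esub> x) = \<zero>\<^bsub>W\<^esub>"
      by (rule T_ker)
    then show ?thesis
      using y assms(2) by simp
  qed
  with U.a_rcos_self[OF assms(2)] have "f ` (ker +>\<^bsub>V\<^esub> x) = {f x}"
    by blast
  then show ?thesis
    by (simp add: kernel_quotient_map_def)
qed

text \<open>The first isomorphism theorem: equal values under \<open>f\<close> mean a difference in
  the kernel, hence equal cosets.\<close>

lemma kernel_quotient_map_bij: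
  assumes "linear_map K V W f" and "f ` carrier V = carrier W"
  shows "bij_betw (kernel_quotient_map f) (carrier (quotient_space V (mod_hom.ker V W f))) (carrier W)"
proof -
  interpret linear_map K V W f by fact
  note [simp] = kernel_quotient_map_coset[OF assms(1)] V.carrier_quotient_space
  have "x \<ominus>\<^bsub>V\<^esub> y \<in> ker" if "x \<in> carrier V" "y \<in> carrier V" "f x = f y" for x y
    using that by (simp add: ker_def W.module.M.r_neg a_minus_def)
  then show ?thesis
    unfolding bij_betw_def using assms(2)
    by (auto simp: inj_on_def V.coset_eq_iff[OF kerT_is_subspace] image_image)
qed

section \<open>Homology of differential spaces\<close>

text \<open>A coset involves only the addition, so homology classes may be written in
  \<open>V\<close> although they are cosets inside the space of cycles.\<close>

lemma a_r_coset_carrier_update: "W +>\<^bsub>V\<lparr>carrier := X\<rparr>\<^esub> v = W +>\<^bsub>V\<^esub> v"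
  by (simp add: a_r_coset_def')

locale differential_space =
  fixes K :: "('k, 'r) ring_scheme" and V :: "('k, 'v, 'm) module_scheme" and d :: "'v \<Rightarrow> 'v"
  assumes linear: "linear_map K V V d"
    and square_zero: "\<And>v. v \<in> carrier V \<Longrightarrow> d (d v) = \<zero>\<^bsub>V\<^esub>"
begin

sublocale linear_map K V V d
  by (fact linear)

abbreviation cycles :: "'v set" where
  "cycles \<equiv> ker"

abbreviation boundaries :: "'v set" where
  "boundaries \<equiv> im"

lemma mem_cycles: "v \<in> cycles \<longleftrightarrow> v \<in> carrier V \<and> d v = \<zero>\<^bsub>V\<^esub>"
  by (simp add: ker_def)

lemma boundaries_subset_cycles: "boundaries \<subseteq> cycles"
  by (auto simp: im_def ker_def square_zero)

lemma boundaries_subspace_cycles: "subspace K boundaries (V\<lparr>carrier := cycles\<rparr>)"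
  by (intro V.subspace_vs_subset imT_is_subspace kerT_is_subspace boundaries_subset_cycles)

lemma cycles_is_vs: "vectorspace K (V\<lparr>carrier := cycles\<rparr>)"
  by (intro V.subspace_is_vs kerT_is_subspace)

lemma carrier_homology: "carrier (homology V d) = (\<lambda>z. boundaries +>\<^bsub>V\<^esub> z) ` cycles"
  by (simp add: homology_def vectorspace.carrier_quotient_space[OF cycles_is_vs] a_r_coset_carrier_update)

end

locale chain_map = source: differential_space K V d + target: differential_space K V' d'
  for K :: "('k, 'r) ring_scheme" and V :: "('k, 'v, 'm) module_scheme" and d
    and V' :: "('k, 'w, 'p) module_scheme" and d' +
  fixes f :: "'v \<Rightarrow> 'w"
  assumes linear: "linear_map K V V' f"
    and commutes: "\<And>v. v \<in> carrier V \<Longrightarrow> f (d v) = d' (f v)"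
begin

sublocale map: linear_map K V V' f
  by (fact linear)

lemma cycles_to_cycles: "z \<in> source.cycles \<Longrightarrow> f z \<in> target.cycles"
  using commutes[of z] by (simp add: source.mem_cycles target.mem_cycles)

lemma boundaries_to_boundaries: "f ` source.boundaries \<subseteq> target.boundaries"
  using commutes by (auto simp: source.im_def target.im_def)

lemma linear_cycles:
  "linear_map K (V\<lparr>carrier := source.cycles\<rparr>) (V'\<lparr>carrier := target.cycles\<rparr>) f"
proof (intro linear_mapI source.cycles_is_vs target.cycles_is_vs module_homI)
  show "f x \<in> carrier (V'\<lparr>carrier := target.cycles\<rparr>)"
    if "x \<in> carrier (V\<lparr>carrier := source.cycles\<rparr>)" for x
    using that cycles_to_cycles by simp
qed (simp_all add: source.mem_cycles)

text \<open>\<open>homology_map\<close> adds sets in all of \<open>V'\<close>, whereas the homology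
  of the target is a quotient of its cycles. Since addition of sets does not look at the carrier,
  the general results on induced maps apply.\<close>

lemma homology_map_eq:
  "homology_map V' d' f = quotient_map (V'\<lparr>carrier := target.cycles\<rparr>) target.boundaries f"
  by (simp add: homology_map_def quotient_map_def set_add_def' fun_eq_iff)

lemma homology_map_class:
  assumes "z \<in> source.cycles"
  shows "homology_map V' d' f (source.boundaries +>\<^bsub>V\<^esub> z) = target.boundaries +>\<^bsub>V'\<^esub> f z"
  using quotient_map_coset[OF linear_cycles source.boundaries_subspace_cycles
      target.boundaries_subspace_cycles boundaries_to_boundaries, of z] assms
  by (simp add: homology_map_eq a_r_coset_carrier_update)

lemma homology_map_linear: "linear_map K (homology V d) (homology V' d') (homology_map V' d' f)"
  unfolding homology_def homology_map_eq
  by (intro quotient_map_linear linear_cycles source.boundaries_subspace_cycles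
      target.boundaries_subspace_cycles boundaries_to_boundaries)

text \<open>No inverse chain map is built: a bounding element, and then a cycle, is pulled back
  through the bijection \<open>f\<close>.\<close>

lemma homology_map_bij:
  assumes "bij_betw f (carrier V) (carrier V')"
  shows "bij_betw (homology_map V' d' f) (carrier (homology V d)) (carrier (homology V' d'))"
proof -
  have inj: "x = y" if "f x = f y" "x \<in> carrier V" "y \<in> carrier V" for x y
    using that assms by (auto simp: bij_betw_def inj_on_def)
  have surj: "\<exists>x\<in>carrier V. f x = y" if "y \<in> carrier V'" for y
    using that assms unfolding bij_betw_def by (metis imageE)
  have "z \<ominus>\<^bsub>V\<^esub> z' \<in> source.boundaries"
    if z: "z \<in> carrier V" "z' \<in> carrier V" and diff: "f z \<ominus>\<^bsub>V'\<^esub> f z' \<in> target.boundaries" for z z'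
  proof -
    obtain y where y: "y \<in> carrier V'" "f z \<ominus>\<^bsub>V'\<^esub> f z' = d' y"
      using diff unfolding target.im_def by blast
    obtain x where x: "x \<in> carrier V" "f x = y"
      using surj y by blast
    \<comment> \<open>Both sides equal \<open>d' y\<close>, so injectivity of \<open>f\<close>
      exhibits \<open>x\<close> as the bounding element in the source.\<close>
    have "f (z \<ominus>\<^bsub>V\<^esub> z') = f (d x)"
      using x y z by (simp add: commutes)
    then have "z \<ominus>\<^bsub>V\<^esub> z' = d x"
      using x z by (intro inj) auto
    then show ?thesis
      using x by (auto simp: source.im_def)
  qed
  then have "inj_on (homology_map V' d' f) (carrier (homology V d))"
    by (auto simp: inj_on_def source.carrier_homology homology_map_class source.mem_cycles
        source.V.coset_eq_iff[OF source.imT_is_subspace]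
        target.V.coset_eq_iff[OF target.imT_is_subspace])
  moreover have "\<exists>x\<in>source.cycles. f x = y" if y: "y \<in> target.cycles" for y
  proof -
    obtain x where x: "x \<in> carrier V" "f x = y"
      using surj y target.mem_cycles by blast
    \<comment> \<open>The preimage of a cycle is a cycle, because \<open>f\<close> sends its
      differential to zero and is injective.\<close>
    have "f (d x) = f \<zero>\<^bsub>V\<^esub>"
      using x y by (simp add: commutes target.mem_cycles)
    then have "d x = \<zero>\<^bsub>V\<^esub>"
      using x by (intro inj) auto
    then show ?thesis
      using x by (auto simp: source.mem_cycles)
  qed
  then have "target.cycles = f ` source.cycles"
    using cycles_to_cycles by blast
  then have "homology_map V' d' f ` carrier (homology V d) = carrier (homology V' d')"
    by (simp add: source.carrier_homology target.carrier_homology image_image homology_map_class)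
  ultimately show ?thesis
    by (simp add: bij_betw_def)
qed

end

lemma chain_map_comp:
  assumes "chain_map K U dU V dV f" and "chain_map K V dV W dW g"
  shows "chain_map K U dU W dW (g \<circ> f)"
proof -
  interpret f: chain_map K U dU V dV f by fact
  interpret g: chain_map K V dV W dW g by fact
  show ?thesis
    by (intro chain_map.intro chain_map_axioms.intro f.source.differential_space_axioms
        g.target.differential_space_axioms linear_map_comp[OF f.linear g.linear])
      (simp add: f.commutes g.commutes)
qed

lemma homology_map_comp:
  assumes "chain_map K U dU V dV f" and "chain_map K V dV W dW g" and "x \<in> carrier (homology U dU)"
  shows "homology_map W dW g (homology_map V dV f x) = homology_map W dW (g \<circ> f) x"
proof -
  interpret f: chain_map K U dU V dV f by fact
  interpret g: chain_map K V dV W dW g by fact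
  interpret gf: chain_map K U dU W dW "g \<circ> f"
    by (rule chain_map_comp[OF assms(1,2)])
  show ?thesis
    using assms(3) f.cycles_to_cycles
    by (auto simp: f.source.carrier_homology f.homology_map_class g.homology_map_class
        gf.homology_map_class)
qed

text \<open>Chain maps that are to be identified may differ as HOL functions outside the carrier, so
  equality is asked only on it.\<close>

lemma homology_map_cong:
  assumes "chain_map K V d V' d' f" and "chain_map K V d V' d' g"
    and "\<And>v. v \<in> carrier V \<Longrightarrow> f v = g v" and "x \<in> carrier (homology V d)"
  shows "homology_map V' d' f x = homology_map V' d' g x"
proof -
  interpret f: chain_map K V d V' d' f by fact
  interpret g: chain_map K V d V' d' g by fact
  show ?thesis
    using assms(3,4)
    by (auto simp: f.source.carrier_homology f.homology_map_class g.homology_map_class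
        f.source.mem_cycles)
qed

section \<open>Chain maps onto quotients and persistence modules\<close>

lemma linear_map_hom:
  assumes "linear_map K V W f"
  shows "f \<in> module_hom K V W"
  using assms by (simp add: linear_map_def mod_hom_def mod_hom_axioms_def)

text \<open>Since \<open>h\<close> is already a function, well-definedness is no issue; linearity is
  checked on preimages under \<open>f\<close>. It applies to maps on cosets, to coordinates and to
  differentials that are known only on the image of a surjection.\<close>

lemma linear_map_surj_factor:
  assumes "linear_map K U V f" and "f ` carrier U = carrier V" and "linear_map K U W g"
    and factor: "\<And>u. u \<in> carrier U \<Longrightarrow> h (f u) = g u"
  shows "linear_map K V W h"
proof -
  interpret f: linear_map K U V f by fact
  interpret g: linear_map K U W g by fact
  have surj: "\<exists>u\<in>carrier U. f u = v" if "v \<in> carrier V" for v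
    using that assms(2) by (metis imageE)
  show ?thesis
  proof (intro linear_mapI f.W.vectorspace_axioms g.W.vectorspace_axioms module_homI)
    show "h v \<in> carrier W" if "v \<in> carrier V" for v
      using surj[OF that] factor by auto
    show "h (v \<oplus>\<^bsub>V\<^esub> v') = h v \<oplus>\<^bsub>W\<^esub> h v'" if v: "v \<in> carrier V" "v' \<in> carrier V" for v v'
    proof -
      obtain u u' where u: "u \<in> carrier U" "f u = v" "u' \<in> carrier U" "f u' = v'"
        using surj v by meson
      then have "h (v \<oplus>\<^bsub>V\<^esub> v') = h (f (u \<oplus>\<^bsub>U\<^esub> u'))"
        by simp
      \<comment> \<open>The sum must stay inside \<open>f\<close> here, so that
        \<open>factor\<close> can be applied at the element \<open>u\<close> plus \<open>u'\<close>
        of \<open>U\<close>.\<close>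
      also have "\<dots> = h (f u) \<oplus>\<^bsub>W\<^esub> h (f u')"
        using u(1,3) by (simp add: factor del: f.f_add)
      finally show ?thesis
        using u by simp
    qed
    show "h (c \<odot>\<^bsub>V\<^esub> v) = c \<odot>\<^bsub>W\<^esub> h v" if c: "c \<in> carrier K" and v: "v \<in> carrier V" for c v
    proof -
      obtain u where u: "u \<in> carrier U" "f u = v"
        using surj v by meson
      then have "h (c \<odot>\<^bsub>V\<^esub> v) = h (f (c \<odot>\<^bsub>U\<^esub> u))"
        using c by simp
      also have "\<dots> = c \<odot>\<^bsub>W\<^esub> h (f u)"
        using u(1) c by (simp add: factor del: f.f_smult)
      finally show ?thesis
        using u by simp
    qed
  qed
qed

text \<open>A surjection transfers the whole structure: linearity of \<open>d'\<close> and the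
  vanishing of its square follow from those of \<open>d\<close>. Quotients and cochain spaces of
  subcomplexes thus become complexes without separate verification.\<close>

lemma chain_map_surj:
  assumes "differential_space K V d" and "linear_map K V W f" and "f ` carrier V = carrier W"
    and commutes: "\<And>v. v \<in> carrier V \<Longrightarrow> f (d v) = d' (f v)"
  shows "chain_map K V d W d' f"
proof -
  interpret d: differential_space K V d by fact
  interpret f: linear_map K V W f by fact
  have "linear_map K W W d'"
    by (rule linear_map_surj_factor[OF assms(2,3) linear_map_comp[OF d.linear assms(2)]])
      (simp add: commutes)
  moreover have "d' (d' w) = \<zero>\<^bsub>W\<^esub>" if w: "w \<in> carrier W" for w
  proof -
    obtain v where v: "v \<in> carrier V" "w = f v"
      using w assms(3) by blast
    then have "d' (d' w) = f (d (d v))"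
      by (simp add: commutes)
    then show ?thesis
      using v by (simp add: d.square_zero)
  qed
  ultimately show ?thesis
    using assms by (simp add: chain_map_def chain_map_axioms_def differential_space_def)
qed

text \<open>Descent along a surjection for chain maps: compatibility of \<open>h\<close> with the
  differentials is tested on preimages, where it follows from that of \<open>f\<close> and
  \<open>g\<close>.\<close>

lemma chain_map_surj_factor:
  assumes "chain_map K U dU V dV f" and "f ` carrier U = carrier V" and "chain_map K U dU W dW g"
    and factor: "\<And>u. u \<in> carrier U \<Longrightarrow> h (f u) = g u"
  shows "chain_map K V dV W dW h"
proof -
  interpret f: chain_map K U dU V dV f by fact
  interpret g: chain_map K U dU W dW g by fact
  have "linear_map K V W h"
    using linear_map_surj_factor[OF f.linear assms(2) g.linear factor] .
  moreover have "h (dV v) = dW (h v)" if v: "v \<in> carrier V" for v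
  proof -
    obtain u where u: "u \<in> carrier U" "v = f u"
      using v assms(2) by blast
    then show ?thesis
      using factor[of u] factor[of "dU u"] f.commutes[of u] g.commutes[of u] by simp
  qed
  ultimately show ?thesis
    by (intro chain_map.intro chain_map_axioms.intro f.target.differential_space_axioms
        g.target.differential_space_axioms)
qed

section \<open>Quotient complexes and the maps between them\<close>

lemma coset_map_linear:
  assumes "vectorspace K V" and "subspace K U V"
  shows "linear_map K V (quotient_space V U) (\<lambda>v. U +>\<^bsub>V\<^esub> v)"
proof -
  interpret vectorspace K V by fact
  show ?thesis
    by (intro linear_mapI assms quotient_space_is_vs module_homI)
      (auto simp: carrier_quotient_space add_quotient_space smult_quotient_space assms)
qed

lemma coset_chain_map:
  assumes "differential_space K V d" and "subspace K U V" and "d ` U \<subseteq> U"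
  shows "chain_map K V d (quotient_space V U) (quotient_map V U d) (\<lambda>v. U +>\<^bsub>V\<^esub> v)"
proof -
  interpret differential_space K V d by fact
  show ?thesis
    using assms(1) coset_map_linear[OF V.vectorspace_axioms assms(2)] V.carrier_quotient_space[symmetric]
    by (rule chain_map_surj) (simp add: quotient_map_coset[OF linear assms(2,2,3)])
qed

lemma quotient_chain_map:
  assumes "differential_space K V d" and "subspace K U V" and "d ` U \<subseteq> U"
    and "subspace K U' V" and "d ` U' \<subseteq> U'" and "U \<subseteq> U'"
  shows "chain_map K (quotient_space V U) (quotient_map V U d)
           (quotient_space V U') (quotient_map V U' d) (quotient_map V U' id)"
proof -
  interpret differential_space K V d by fact
  have "linear_map K V V id"
    by (intro linear_mapI V.vectorspace_axioms module_homI) auto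
  then have "quotient_map V U' id (U +>\<^bsub>V\<^esub> v) = U' +>\<^bsub>V\<^esub> v" if "v \<in> carrier V" for v
    using quotient_map_coset[of K V V id U U' v] assms that by simp
  then show ?thesis
    by (rule chain_map_surj_factor[OF coset_chain_map[OF assms(1-3)] V.carrier_quotient_space[symmetric]
          coset_chain_map[OF assms(1,4,5)]])
qed

text \<open>This lets the differential descend to the quotient by the kernel. Once a filtration step
  is recognised as a kernel, its invariance comes for free.\<close>

lemma (in chain_map) kernel_invariant: "d ` mod_hom.ker V V' f \<subseteq> mod_hom.ker V V' f"
  using commutes by (auto simp: map.ker_def)

lemma kernel_quotient_chain_map:
  assumes "chain_map K V d W d' f"
  defines "U \<equiv> mod_hom.ker V W f"
  shows "chain_map K (quotient_space V U) (quotient_map V U d) W d' (kernel_quotient_map f)"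
proof -
  interpret chain_map K V d W d' f by fact
  have U: "subspace K U V" "d ` U \<subseteq> U"
    using kernel_invariant map.kerT_is_subspace by (simp_all add: U_def)
  have "kernel_quotient_map f (U +>\<^bsub>V\<^esub> v) = f v" if "v \<in> carrier V" for v
    unfolding U_def by (rule kernel_quotient_map_coset[OF linear that])
  then show ?thesis
    by (rule chain_map_surj_factor[OF coset_chain_map[OF source.differential_space_axioms U]
          source.V.carrier_quotient_space[symmetric] assms(1)])
qed

section \<open>Isomorphisms of persistence modules\<close>

lemma pmodule_iso_trans:
  assumes "pmodule_iso K m P Q" and "pmodule_iso K m Q R"
  shows "pmodule_iso K m P R"
proof -
  obtain \<phi> where \<phi>: "\<And>i. i < m \<Longrightarrow> \<phi> i \<in> module_hom K (pspace P i) (pspace Q i)"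
      "\<And>i. i < m \<Longrightarrow> bij_betw (\<phi> i) (carrier (pspace P i)) (carrier (pspace Q i))"
      "\<And>i x. Suc i < m \<Longrightarrow> x \<in> carrier (pspace P i) \<Longrightarrow> \<phi> (Suc i) (pmap P i x) = pmap Q i (\<phi> i x)"
    using assms(1) unfolding pmodule_iso_def by blast
  obtain \<psi> where \<psi>: "\<And>i. i < m \<Longrightarrow> \<psi> i \<in> module_hom K (pspace Q i) (pspace R i)"
      "\<And>i. i < m \<Longrightarrow> bij_betw (\<psi> i) (carrier (pspace Q i)) (carrier (pspace R i))"
      "\<And>i x. Suc i < m \<Longrightarrow> x \<in> carrier (pspace Q i) \<Longrightarrow> \<psi> (Suc i) (pmap Q i x) = pmap R i (\<psi> i x)"
    using assms(2) unfolding pmodule_iso_def by blast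
  \<comment> \<open>The square for \<open>\<psi>\<close> commutes only on the carrier, so the values
    of \<open>\<phi>\<close> must be located there before the squares are pasted.\<close>
  have "\<phi> i x \<in> carrier (pspace Q i)" if "i < m" "x \<in> carrier (pspace P i)" for i x
    using \<phi>(1) that module_hom_closed by blast
  then have "(\<psi> (Suc i) \<circ> \<phi> (Suc i)) (pmap P i x) = pmap R i ((\<psi> i \<circ> \<phi> i) x)"
    if "Suc i < m" "x \<in> carrier (pspace P i)" for i x
    using that by (simp add: \<phi>(3) \<psi>(3))
  then have "\<exists>\<chi>. (\<forall>i<m. \<chi> i \<in> module_hom K (pspace P i) (pspace R i) \<and>
                bij_betw (\<chi> i) (carrier (pspace P i)) (carrier (pspace R i))) \<and>
          (\<forall>i. Suc i < m \<longrightarrow>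
             (\<forall>x\<in>carrier (pspace P i). \<chi> (Suc i) (pmap P i x) = pmap R i (\<chi> i x)))"
    using module_hom_comp[OF \<phi>(1) \<psi>(1)] bij_betw_trans[OF \<phi>(2) \<psi>(2)]
    by (intro exI[of _ "\<lambda>i. \<psi> i \<circ> \<phi> i"]) blast
  then show ?thesis
    using assms unfolding pmodule_iso_def by blast
qed

text \<open>The chain isomorphisms \<open>V / ker (f i) \<cong> W i\<close> commute with the maps of both sequences, so
  they induce an isomorphism of persistence modules in homology.\<close>

lemma persistent_relative_homology_iso:
  fixes W :: "nat \<Rightarrow> ('k, 'w, 'q) module_scheme"
  assumes "differential_space K V d"
    and lin: "\<And>i. i < n \<Longrightarrow> linear_map K V (W i) (f i)"
    and surj: "\<And>i. i < n \<Longrightarrow> f i ` carrier V = carrier (W i)"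
    and ker: "\<And>i. i < n \<Longrightarrow> mod_hom.ker V (W i) (f i) = filtration K V e i"
    and comm: "\<And>i v. i < n \<Longrightarrow> v \<in> carrier V \<Longrightarrow> f i (d v) = \<delta> i (f i v)"
    and res: "\<And>i v. Suc i < n \<Longrightarrow> v \<in> carrier V \<Longrightarrow> r i (f i v) = f (Suc i) v"
  shows "pmodule_iso K n (persistent_relative_homology K V d e)
    \<lparr>pspace = \<lambda>i. homology (W i) (\<delta> i),
     pmap = \<lambda>i. homology_map (W (Suc i)) (\<delta> (Suc i)) (r i)\<rparr>"
proof -
  define C where "C = filtration K V e"
  define Q where "Q = (\<lambda>i. quotient_space V (C i))"
  define dQ where "dQ = (\<lambda>i. quotient_map V (C i) d)"
  interpret D: differential_space K V d by fact
  have f: "chain_map K V d (W i) (\<delta> i) (f i)" if "i < n" for i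
    by (rule chain_map_surj) (fact assms(1) | simp add: lin surj comm that)+
  have C: "mod_hom.ker V (W i) (f i) = C i" "subspace K (C i) V" "d ` C i \<subseteq> C i" if "i < n" for i
    using ker[OF that] chain_map.kernel_invariant[OF f[OF that]]
      linear_map.kerT_is_subspace[OF lin[OF that]] by (simp_all add: C_def)
  \<comment> \<open>Monotonicity of the filtration is read off from the maps:
    \<open>f (Suc i)\<close> factors through \<open>f i\<close>, so its kernel is the larger
    one.\<close>
  have C_mono: "C i \<subseteq> C (Suc i)" if i: "Suc i < n" for i
  proof
    fix v assume v: "v \<in> C i"
    interpret f: linear_map K V "W i" "f i"
      using i by (intro lin) simp
    interpret f': linear_map K V "W (Suc i)" "f (Suc i)"
      using i by (intro lin)
    have v': "v \<in> carrier V" "f i v = f i \<zero>\<^bsub>V\<^esub>"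
      using v i C(1)[of i] by (auto simp: f.ker_def)
    have "f (Suc i) v = f (Suc i) \<zero>\<^bsub>V\<^esub>"
      using res[OF i v'(1)] res[OF i, of "\<zero>\<^bsub>V\<^esub>"] v'(2) by simp
    then show "v \<in> C (Suc i)"
      using v' i C(1)[of "Suc i"] by (auto simp: f'.ker_def)
  qed
  have g: "chain_map K (Q i) (dQ i) (W i) (\<delta> i) (kernel_quotient_map (f i))" if "i < n" for i
    using kernel_quotient_chain_map[OF f[OF that]] C(1)[OF that] by (simp add: Q_def dQ_def)
  have g_bij: "bij_betw (kernel_quotient_map (f i)) (carrier (Q i)) (carrier (W i))" if "i < n" for i
    using kernel_quotient_map_bij[OF lin[OF that] surj[OF that]] C(1)[OF that] by (simp add: Q_def)
  have p: "chain_map K (Q i) (dQ i) (Q (Suc i)) (dQ (Suc i)) (quotient_map V (C (Suc i)) id)"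
    if "Suc i < n" for i
    using quotient_chain_map[OF assms(1), of "C i" "C (Suc i)"] C[of i] C[of "Suc i"] C_mono[of i] that
    by (simp add: Q_def dQ_def)
  have r: "chain_map K (W i) (\<delta> i) (W (Suc i)) (\<delta> (Suc i)) (r i)" if "Suc i < n" for i
    using that by (intro chain_map_surj_factor[OF f surj f res]) auto
  define \<phi> where "\<phi> = (\<lambda>i. homology_map (W i) (\<delta> i) (kernel_quotient_map (f i)))"
  have \<phi>: "linear_map K (homology (Q i) (dQ i)) (homology (W i) (\<delta> i)) (\<phi> i)"
    "bij_betw (\<phi> i) (carrier (homology (Q i) (dQ i))) (carrier (homology (W i) (\<delta> i)))"
    if "i < n" for i
    using chain_map.homology_map_linear[OF g[OF that]] chain_map.homology_map_bij[OF g[OF that] g_bij[OF that]]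
    by (simp_all add: \<phi>_def)
  have natural: "\<phi> (Suc i) (homology_map (Q (Suc i)) (dQ (Suc i)) (quotient_map V (C (Suc i)) id) x)
      = homology_map (W (Suc i)) (\<delta> (Suc i)) (r i) (\<phi> i x)"
    if i: "Suc i < n" and x: "x \<in> carrier (homology (Q i) (dQ i))" for i x
  proof -
    \<comment> \<open>The square on chains: both paths send the coset of \<open>v\<close> to
      \<open>f (Suc i) v\<close>.\<close>
    have "(kernel_quotient_map (f (Suc i)) \<circ> quotient_map V (C (Suc i)) id) y
        = (r i \<circ> kernel_quotient_map (f i)) y" if y: "y \<in> carrier (Q i)" for y
    proof -
      obtain v where v: "v \<in> carrier V" "y = C i +>\<^bsub>V\<^esub> v"
        using y by (auto simp: Q_def D.V.carrier_quotient_space)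
      have id: "linear_map K V V id"
        by (intro linear_mapI D.V.vectorspace_axioms module_homI) auto
      have "quotient_map V (C (Suc i)) id y = C (Suc i) +>\<^bsub>V\<^esub> v"
        using quotient_map_coset[OF id, of "C i" "C (Suc i)" v] C[of i] C[of "Suc i"] C_mono[OF i] i v
        by simp
      then show ?thesis
        using kernel_quotient_map_coset[OF lin v(1), of i] kernel_quotient_map_coset[OF lin v(1), of "Suc i"]
          C(1)[of i] C(1)[of "Suc i"] i v res by simp
    qed
    from homology_map_cong[OF chain_map_comp[OF p[OF i] g[OF i]]
        chain_map_comp[OF g[OF Suc_lessD[OF i]] r[OF i]] this x]
    show ?thesis
      using homology_map_comp[OF p[OF i] g[OF i] x]
        homology_map_comp[OF g[OF Suc_lessD[OF i]] r[OF i] x] by (simp only: \<phi>_def)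
  qed
  have sequence: "persistent_relative_homology K V d e =
    \<lparr>pspace = \<lambda>i. homology (Q i) (dQ i),
     pmap = \<lambda>i. homology_map (Q (Suc i)) (dQ (Suc i)) (quotient_map V (C (Suc i)) id)\<rparr>"
    by (simp add: persistent_relative_homology_def Let_def Q_def dQ_def C_def)
  \<comment> \<open>The spaces of both sequences are vector spaces because they are source and
    target of the linear maps \<open>\<phi> i\<close>.\<close>
  have "persistence_module K n (persistent_relative_homology K V d e)"
    unfolding persistence_module_def sequence
    using linear_map.axioms(1)[OF \<phi>(1)] chain_map.homology_map_linear[OF p, THEN linear_map_hom] by simp
  moreover have "persistence_module K n \<lparr>pspace = \<lambda>i. homology (W i) (\<delta> i),
     pmap = \<lambda>i. homology_map (W (Suc i)) (\<delta> (Suc i)) (r i)\<rparr>"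
    unfolding persistence_module_def
    using linear_map.axioms(2)[OF \<phi>(1)] chain_map.homology_map_linear[OF r, THEN linear_map_hom] by simp
  ultimately show ?thesis
    unfolding pmodule_iso_def sequence
    using linear_map_hom[OF \<phi>(1)] \<phi>(2) natural by (intro conjI exI[of _ \<phi>]) simp_all
qed

section \<open>Coordinates\<close>

text \<open>Coefficients are indexed by positions and not by vectors, as in
  \<open>coordinate\<close>. Coefficient families then form a function space, in which the standard
  cells live.\<close>

definition family_comb ::
    "('k, 'v, 'm) module_scheme \<Rightarrow> 'i set \<Rightarrow> ('i \<Rightarrow> 'v) \<Rightarrow> ('i \<Rightarrow> 'k) \<Rightarrow> 'v" where
  "family_comb V I e a = (\<Oplus>\<^bsub>V\<^esub>j\<in>I. a j \<odot>\<^bsub>V\<^esub> e j)"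

text \<open>Finiteness of \<open>A\<close> is not assumed: over an infinite set both sums are zero
  by convention, and \<open>T\<close> preserves zero.\<close>

lemma (in linear_map) map_finsum:
  assumes "g \<in> A \<rightarrow> carrier V"
  shows "T (\<Oplus>\<^bsub>V\<^esub>a\<in>A. g a) = (\<Oplus>\<^bsub>W\<^esub>a\<in>A. T (g a))"
  using assms
proof (induction A rule: infinite_finite_induct)
  case (insert a A)
  then have "g a \<in> carrier V" "g \<in> A \<rightarrow> carrier V" "(\<lambda>a. T (g a)) \<in> A \<rightarrow> carrier W"
    by (auto simp: Pi_iff)
  with insert show ?case
    by (simp add: V.module.M.finsum_insert W.module.M.finsum_insert)
qed auto

context vectorspace
begin

lemma family_comb_closed:
  assumes "e \<in> I \<rightarrow> carrier V" and "a \<in> I \<rightarrow> carrier K"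
  shows "family_comb V I e a \<in> carrier V"
  unfolding family_comb_def using assms by (intro M.finsum_closed) (auto simp: Pi_iff)

lemma family_comb_linear:
  assumes "e \<in> I \<rightarrow> carrier V"
  shows "linear_map K (func_space I) V (family_comb V I e)"
proof (intro linear_mapI func_space_is_vs vectorspace_axioms module_homI)
  fix a b assume ab: "a \<in> carrier (func_space I)" "b \<in> carrier (func_space I)"
  then show "family_comb V I e a \<in> carrier V"
    using assms by (intro family_comb_closed) (auto simp: func_space_def)
  have [simp]: "a j \<in> carrier K" "b j \<in> carrier K" "e j \<in> carrier V" if "j \<in> I" for j
    using ab assms that by (auto simp: func_space_def)
  have "family_comb V I e (a \<oplus>\<^bsub>func_space I\<^esub> b) = (\<Oplus>\<^bsub>V\<^esub>j\<in>I. a j \<odot>\<^bsub>V\<^esub> e j \<oplus>\<^bsub>V\<^esub> b j \<odot>\<^bsub>V\<^esub> e j)"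
    unfolding family_comb_def by (intro M.finsum_cong') (auto simp: func_space_def smult_l_distr)
  then show "family_comb V I e (a \<oplus>\<^bsub>func_space I\<^esub> b) = family_comb V I e a \<oplus>\<^bsub>V\<^esub> family_comb V I e b"
    unfolding family_comb_def by (subst (asm) M.finsum_addf) auto
  fix c assume c: "c \<in> carrier K"
  have "family_comb V I e (c \<odot>\<^bsub>func_space I\<^esub> a) = (\<Oplus>\<^bsub>V\<^esub>j\<in>I. c \<odot>\<^bsub>V\<^esub> (a j \<odot>\<^bsub>V\<^esub> e j))"
    unfolding family_comb_def using c by (intro M.finsum_cong') (auto simp: func_space_def smult_assoc1)
  then show "family_comb V I e (c \<odot>\<^bsub>func_space I\<^esub> a) = c \<odot>\<^bsub>V\<^esub> family_comb V I e a"
    unfolding family_comb_def using c by (subst finsum_smult) auto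
qed

lemma family_comb_standard_cell:
  assumes "e \<in> {1..n} \<rightarrow> carrier V" and "j \<in> {1..n}"
  shows "family_comb V {1..n} e (standard_cell K n j) = e j"
proof -
  have "family_comb V {1..n} e (standard_cell K n j)
      = (\<Oplus>\<^bsub>V\<^esub>i\<in>{1..n}. if j = i then e i else \<zero>\<^bsub>V\<^esub>)"
    unfolding family_comb_def using assms
    by (intro M.finsum_cong') (auto simp: standard_cell_def Pi_iff)
  also have "\<dots> = e j"
    using assms by (intro M.finsum_singleton) auto
  finally show ?thesis .
qed

lemma standard_cell_closed: "standard_cell K n j \<in> carrier (func_space {1..n})"
  by (auto simp: standard_cell_def func_space_def)

text \<open>Bridge from coefficients attached to vectors to coefficients attached to indices;
  injectivity of \<open>e\<close> keeps repeated vectors from being counted once only.\<close>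

lemma lincomb_image:
  assumes "inj_on e I" and "e \<in> I \<rightarrow> carrier V" and "a \<in> e ` I \<rightarrow> carrier K"
  shows "lincomb a (e ` I) = family_comb V I e (\<lambda>j\<in>I. a (e j))"
proof -
  have "lincomb a (e ` I) = (\<Oplus>\<^bsub>V\<^esub>j\<in>I. a (e j) \<odot>\<^bsub>V\<^esub> e j)"
    unfolding lincomb_def using assms by (subst M.finsum_reindex) (auto simp: Pi_iff)
  also have "\<dots> = family_comb V I e (\<lambda>j\<in>I. a (e j))"
    unfolding family_comb_def using assms by (intro M.finsum_cong') (auto simp: Pi_iff)
  finally show ?thesis .
qed

lemma family_comb_bij:
  assumes "finite I" and "inj_on e I" and "e \<in> I \<rightarrow> carrier V" and "basis (e ` I)"
  shows "bij_betw (family_comb V I e) (carrier (func_space I)) (carrier V)"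
proof -
  have unique: "\<exists>!a. a \<in> e ` I \<rightarrow>\<^sub>E carrier K \<and> lincomb a (e ` I) = v" if "v \<in> carrier V" for v
    using basis_criterion[OF finite_imageI[OF assms(1)] image_subset_iff_funcset[THEN iffD2, OF assms(3)]]
      assms(4) that by blast
  \<comment> \<open>Transports coefficients from indices to vectors along the inverse of
    \<open>e\<close>; composing with \<open>e\<close> undoes it, so uniqueness of coefficients
    carries over.\<close>
  define lift where "lift = (\<lambda>a. \<lambda>x\<in>e ` I. a (inv_into I e x) :: 'a)"
  have lift: "lift a \<in> e ` I \<rightarrow>\<^sub>E carrier K" "(\<lambda>j\<in>I. lift a (e j)) = a"
    if "a \<in> I \<rightarrow>\<^sub>E carrier K" for a
  proof -
    show "lift a \<in> e ` I \<rightarrow>\<^sub>E carrier K"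
      using that assms(2) by (auto simp: lift_def)
    show "(\<lambda>j\<in>I. lift a (e j)) = a"
      using that assms(2) by (intro ext) (auto simp: lift_def restrict_def PiE_def extensional_def)
  qed
  have comb: "family_comb V I e a = lincomb (lift a) (e ` I)" if "a \<in> I \<rightarrow>\<^sub>E carrier K" for a
    using lincomb_image[OF assms(2,3), of "lift a"] lift[OF that] by (simp add: PiE_def)
  have "a = b" if ab: "a \<in> I \<rightarrow>\<^sub>E carrier K" "b \<in> I \<rightarrow>\<^sub>E carrier K"
    and "family_comb V I e a = family_comb V I e b" for a b
  proof -
    have "family_comb V I e a \<in> carrier V"
      using ab assms(3) by (intro family_comb_closed) auto
    then have "lift a = lift b"
      using unique that(3) lift(1)[OF ab(1)] lift(1)[OF ab(2)] comb[OF ab(1)] comb[OF ab(2)] by metis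
    then show ?thesis
      using lift(2)[OF ab(1)] lift(2)[OF ab(2)] by metis
  qed
  then have "inj_on (family_comb V I e) (I \<rightarrow>\<^sub>E carrier K)"
    by (rule inj_onI)
  moreover have "\<exists>a\<in>I \<rightarrow>\<^sub>E carrier K. family_comb V I e a = v" if v: "v \<in> carrier V" for v
  proof -
    obtain a where a: "a \<in> e ` I \<rightarrow>\<^sub>E carrier K" "lincomb a (e ` I) = v"
      using unique[OF v] by blast
    then have "a \<in> e ` I \<rightarrow> carrier K"
      by (simp add: PiE_def)
    with a show ?thesis
      using lincomb_image[OF assms(2,3), of a] by (intro bexI[of _ "\<lambda>j\<in>I. a (e j)"]) auto
  qed
  then have "family_comb V I e ` (I \<rightarrow>\<^sub>E carrier K) = carrier V"
    using family_comb_closed[OF assms(3)] by (auto simp: PiE_iff)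
  ultimately show ?thesis
    by (simp add: bij_betw_def func_space_def)
qed

text \<open>Injectivity settles the definite description. The hypothesis is bijectivity of the
  combination map, which serves both the cells, where it comes from the basis property, and the dual
  family, where it comes from evaluation on cells.\<close>

lemma coordinate_family_comb:
  assumes "bij_betw (family_comb V {1..n} e) (carrier (func_space {1..n})) (carrier V)"
    and "a \<in> carrier (func_space {1..n})"
  shows "coordinate K V n e i (family_comb V {1..n} e a) = a i"
proof -
  have inj: "inj_on (family_comb V {1..n} e) ({1..n} \<rightarrow>\<^sub>E carrier K)" and a: "a \<in> {1..n} \<rightarrow>\<^sub>E carrier K"
    using assms by (simp_all add: bij_betw_def func_space_def)
  have "(THE b. b \<in> {1..n} \<rightarrow>\<^sub>E carrier K \<and> family_comb V {1..n} e a = family_comb V {1..n} e b) = a"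
    using a inj_onD[OF inj _ a] by (intro the_equality) auto
  then show ?thesis
    by (simp add: coordinate_def family_comb_def)
qed

lemma base_field_is_vs: "vectorspace K (base_field K)"
  by (rule vs_criteria)
    (auto simp: base_field_def R.a_ac m_assoc l_distr r_distr field_axioms intro: R.r_neg R.add.inv_closed)

lemma evaluation_linear:
  assumes "i \<in> I"
  shows "linear_map K (func_space I) (base_field K) (\<lambda>a. a i)"
  using assms by (intro linear_mapI func_space_is_vs base_field_is_vs module_homI)
    (auto simp: func_space_def base_field_def)

text \<open>Precomposed with the surjective combination map, a coordinate becomes evaluation at
  \<open>i\<close>, which is visibly linear.\<close>

lemma coordinate_linear:
  assumes "bij_betw (family_comb V {1..n} e) (carrier (func_space {1..n})) (carrier V)"
    and "e \<in> {1..n} \<rightarrow> carrier V" and "i \<in> {1..n}"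
  shows "linear_map K V (base_field K) (coordinate K V n e i)"
  using assms coordinate_family_comb[OF assms(1)]
  by (intro linear_map_surj_factor[OF family_comb_linear[OF assms(2)] _ evaluation_linear[OF assms(3)]])
    (auto simp: bij_betw_def)

section \<open>Matrices acting on coordinate vectors\<close>

lemma matrix_map_linear:
  assumes D: "\<And>i j. i \<in> {1..n} \<Longrightarrow> j \<in> {1..n} \<Longrightarrow> D i j \<in> carrier K"
  shows "linear_map K (func_space {1..n}) (func_space {1..n}) (matrix_map K n D)"
proof (intro linear_mapI func_space_is_vs module_homI)
  fix a b assume ab: "a \<in> carrier (func_space {1..n})" "b \<in> carrier (func_space {1..n})"
  have [simp]: "a j \<in> carrier K" "b j \<in> carrier K" if "j \<in> {1..n}" for j
    using ab that by (auto simp: func_space_def)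
  show "matrix_map K n D a \<in> carrier (func_space {1..n})"
    using D by (auto simp: matrix_map_def func_space_def intro!: R.finsum_closed)
  have "(\<Oplus>\<^bsub>K\<^esub>j\<in>{1..n}. D i j \<otimes>\<^bsub>K\<^esub> (a \<oplus>\<^bsub>func_space {1..n}\<^esub> b) j)
      = (\<Oplus>\<^bsub>K\<^esub>j\<in>{1..n}. D i j \<otimes>\<^bsub>K\<^esub> a j) \<oplus>\<^bsub>K\<^esub> (\<Oplus>\<^bsub>K\<^esub>j\<in>{1..n}. D i j \<otimes>\<^bsub>K\<^esub> b j)"
    if i: "i \<in> {1..n}" for i
  proof -
    have "(\<Oplus>\<^bsub>K\<^esub>j\<in>{1..n}. D i j \<otimes>\<^bsub>K\<^esub> (a \<oplus>\<^bsub>func_space {1..n}\<^esub> b) j)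
        = (\<Oplus>\<^bsub>K\<^esub>j\<in>{1..n}. D i j \<otimes>\<^bsub>K\<^esub> a j \<oplus>\<^bsub>K\<^esub> D i j \<otimes>\<^bsub>K\<^esub> b j)"
      using D[OF i] by (intro R.finsum_cong') (auto simp: func_space_def r_distr)
    also have "\<dots> = (\<Oplus>\<^bsub>K\<^esub>j\<in>{1..n}. D i j \<otimes>\<^bsub>K\<^esub> a j) \<oplus>\<^bsub>K\<^esub> (\<Oplus>\<^bsub>K\<^esub>j\<in>{1..n}. D i j \<otimes>\<^bsub>K\<^esub> b j)"
      using D[OF i] by (intro R.finsum_addf) auto
    finally show ?thesis .
  qed
  then show "matrix_map K n D (a \<oplus>\<^bsub>func_space {1..n}\<^esub> b)
      = matrix_map K n D a \<oplus>\<^bsub>func_space {1..n}\<^esub> matrix_map K n D b"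
    by (auto simp: matrix_map_def func_space_def)
  fix c assume c: "c \<in> carrier K"
  have "(\<Oplus>\<^bsub>K\<^esub>j\<in>{1..n}. D i j \<otimes>\<^bsub>K\<^esub> (c \<odot>\<^bsub>func_space {1..n}\<^esub> a) j)
      = c \<otimes>\<^bsub>K\<^esub> (\<Oplus>\<^bsub>K\<^esub>j\<in>{1..n}. D i j \<otimes>\<^bsub>K\<^esub> a j)"
    if i: "i \<in> {1..n}" for i
    using D[OF i] c by (subst R.finsum_rdistr)
      (auto simp: func_space_def m_lcomm intro!: R.finsum_cong')
  then show "matrix_map K n D (c \<odot>\<^bsub>func_space {1..n}\<^esub> a) = c \<odot>\<^bsub>func_space {1..n}\<^esub> matrix_map K n D a"
    by (auto simp: matrix_map_def func_space_def)
qed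

end

lemma func_space_vs:
  assumes "field K"
  shows "vectorspace K (ring.func_space K S)"
proof -
  interpret field K by fact
  show ?thesis
    using func_space_is_module by (simp add: vectorspace_def assms)
qed

text \<open>Turns a step of the standard filtration into a vanishing condition on coordinates, the
  form in which a kernel of restrictions can be recognised.\<close>

lemma span_standard_cells:
  assumes "field K" and "i \<le> n"
  shows "module.span K (ring.func_space K {1..n}) (standard_cell K n ` {1..i})
    = {x \<in> carrier (ring.func_space K {1..n}). \<forall>j\<in>{i<..n}. x j = \<zero>\<^bsub>K\<^esub>}" (is "?span i = ?X i")
proof -
  interpret F: vectorspace K "ring.func_space K {1..n}"
    by (rule func_space_vs[OF assms(1)])
  have cells: "standard_cell K n ` S \<subseteq> carrier (ring.func_space K {1..n})" for S
    by (auto simp: standard_cell_def ring.func_space_def[OF F.R.ring_axioms])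
  have "submodule K (?X i) (ring.func_space K {1..n})"
    by unfold_locales (auto simp: ring.func_space_def[OF F.R.ring_axioms])
  moreover have "standard_cell K n j \<in> ?X i" if "j \<in> {1..i}" for j
    using that cells[of "{j}"] by (auto simp: standard_cell_def)
  ultimately have "?span i \<subseteq> ?X i"
    by (intro F.span_is_subset) blast
  moreover have "?X i \<subseteq> ?span i"
    using assms(2)
  proof (induction i)
    case 0
    \<comment> \<open>With all coordinates zero, \<open>x\<close> is the zero vector as a HOL
      function because it is extensional.\<close>
    have "x = \<zero>\<^bsub>ring.func_space K {1..n}\<^esub>" if "x \<in> ?X 0" for x
      using that by (auto simp: ring.func_space_def[OF F.R.ring_axioms] PiE_def extensional_def restrict_def fun_eq_iff)
    then show ?case
      using F.span_zero by auto
  next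
    case (Suc i)
    interpret S: submodule K "?span (Suc i)" "ring.func_space K {1..n}"
      by (intro F.span_is_submodule cells)
    show ?case
    proof
      fix x assume x: "x \<in> ?X (Suc i)"
      \<comment> \<open>Clearing coordinate \<open>Suc i\<close> leaves a vector covered by the
        induction hypothesis; the difference is a multiple of one standard cell.\<close>
      define y where "y = x(Suc i := \<zero>\<^bsub>K\<^esub>)"
      have "y \<in> ?X i"
        using x Suc.prems by (auto simp: y_def ring.func_space_def[OF F.R.ring_axioms] PiE_def extensional_def)
      moreover have "?span i \<subseteq> ?span (Suc i)"
        by (intro F.span_is_monotone image_mono) auto
      ultimately have y: "y \<in> ?span (Suc i)"
        using Suc.IH Suc.prems by (meson Suc_leD subsetD)
      have "standard_cell K n (Suc i) \<in> ?span (Suc i)"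
        by (intro subsetD[OF F.in_own_span[OF cells]] imageI) auto
      moreover have "x (Suc i) \<in> carrier K"
        using x Suc.prems by (auto simp: ring.func_space_def[OF F.R.ring_axioms])
      moreover have "x = y \<oplus>\<^bsub>ring.func_space K {1..n}\<^esub> x (Suc i) \<odot>\<^bsub>ring.func_space K {1..n}\<^esub> standard_cell K n (Suc i)"
        using x Suc.prems
        by (intro ext) (auto simp: y_def ring.func_space_def[OF F.R.ring_axioms] standard_cell_def restrict_def PiE_def
            extensional_def Pi_iff)
      ultimately show "x \<in> ?span (Suc i)"
        using y S.m_closed S.smult_closed by metis
    qed
  qed
  ultimately show ?thesis
    by blast
qed

section \<open>Dual spaces\<close>

context vectorspace
begin

text \<open>A sum depends only on carrier, addition and zero, which \<open>K\<close> and
  \<open>base_field K\<close> share.\<close>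

lemma finsum_base_field: "finsum (base_field K) g A = finsum K g A"
  by (simp add: finsum_def finprod_def base_field_def)

lemma carrier_dual_space:
  "\<phi> \<in> carrier (dual_space K V) \<longleftrightarrow> linear_map K V (base_field K) \<phi> \<and> \<phi> \<in> extensional (carrier V)"
  using linear_mapI[OF vectorspace_axioms base_field_is_vs] linear_map_hom
  by (auto simp: dual_space_def)

text \<open>The functionals form a subspace of the space of all functions from the carrier to
  \<open>K\<close>.\<close>

lemma dual_space_is_vs: "vectorspace K (dual_space K V)"
proof -
  interpret F: vectorspace K "func_space (carrier V)"
    by (rule func_space_is_vs)
  let ?H = "module_hom K V (base_field K) \<inter> extensional (carrier V)"
  have "submodule K ?H (func_space (carrier V))"
  proof (rule submodule.intro)
    \<comment> \<open>\<open>H\<close> and \<open>I\<close> exchange membership for plain identities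
      in \<open>K\<close>, so that the closure properties become field arithmetic.\<close>
    have H: "\<phi> x \<in> carrier K"
      "\<And>y. y \<in> carrier V \<Longrightarrow> \<phi> (x \<oplus>\<^bsub>V\<^esub> y) = \<phi> x \<oplus>\<^bsub>K\<^esub> \<phi> y"
      "\<And>c. c \<in> carrier K \<Longrightarrow> \<phi> (c \<odot>\<^bsub>V\<^esub> x) = c \<otimes>\<^bsub>K\<^esub> \<phi> x"
      if "\<phi> \<in> ?H" and "x \<in> carrier V" for \<phi> x
      using that module_hom_closed[of \<phi> K V "base_field K"]
        module_hom_add[of \<phi> K V "base_field K" x] module_hom_smult[of \<phi> K V "base_field K" _ x]
      by (auto simp: base_field_def)
    have I: "\<phi> \<in> ?H"
      if "\<And>x. x \<in> carrier V \<Longrightarrow> \<phi> x \<in> carrier K"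
        and "\<And>x y. x \<in> carrier V \<Longrightarrow> y \<in> carrier V \<Longrightarrow> \<phi> (x \<oplus>\<^bsub>V\<^esub> y) = \<phi> x \<oplus>\<^bsub>K\<^esub> \<phi> y"
        and "\<And>c x. c \<in> carrier K \<Longrightarrow> x \<in> carrier V \<Longrightarrow> \<phi> (c \<odot>\<^bsub>V\<^esub> x) = c \<otimes>\<^bsub>K\<^esub> \<phi> x"
        and "\<phi> \<in> extensional (carrier V)" for \<phi>
      using that by (intro IntI module_homI) (simp_all add: base_field_def)
    show "module K (func_space (carrier V))"
      by (rule func_space_is_module)
    show "?H \<subseteq> carrier (func_space (carrier V))"
      using H(1) by (auto simp: func_space_def PiE_iff simp del: restrict_extensional intro: extensional_arb)
    show "\<phi> \<oplus>\<^bsub>func_space (carrier V)\<^esub> \<psi> \<in> ?H" if "\<phi> \<in> ?H" "\<psi> \<in> ?H" for \<phi> \<psi>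
      by (intro I) (simp_all add: func_space_def H[OF that(1)] H[OF that(2)] R.a_ac r_distr)
    show "\<zero>\<^bsub>func_space (carrier V)\<^esub> \<in> ?H"
      by (intro I) (simp_all add: func_space_def)
    show "c \<odot>\<^bsub>func_space (carrier V)\<^esub> \<phi> \<in> ?H" if "c \<in> carrier K" "\<phi> \<in> ?H" for c \<phi>
      by (intro I) (simp_all add: func_space_def H[OF that(2)] that(1) r_distr m_lcomm)
  qed
  then show ?thesis
    unfolding dual_space_def by (intro F.subspace_is_vs) (simp add: subspace_def F.vectorspace_axioms)
qed

lemma dual_space_simps:
  "\<phi> \<oplus>\<^bsub>dual_space K V\<^esub> \<psi> = (\<lambda>v\<in>carrier V. \<phi> v \<oplus>\<^bsub>K\<^esub> \<psi> v)"
  "c \<odot>\<^bsub>dual_space K V\<^esub> \<phi> = (\<lambda>v\<in>carrier V. c \<otimes>\<^bsub>K\<^esub> \<phi> v)"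
  "\<zero>\<^bsub>dual_space K V\<^esub> = (\<lambda>v\<in>carrier V. \<zero>\<^bsub>K\<^esub>)"
  by (simp_all add: dual_space_def func_space_def)

lemma dual_closed:
  assumes "\<phi> \<in> carrier (dual_space K V)" and "v \<in> carrier V"
  shows "\<phi> v \<in> carrier K"
  using assms module_hom_closed[of \<phi> K V "base_field K"] by (auto simp: dual_space_def base_field_def)

text \<open>Used to apply a finite sum of functionals to a vector term by term.\<close>

lemma dual_evaluation_linear:
  assumes "v \<in> carrier V"
  shows "linear_map K (dual_space K V) (base_field K) (\<lambda>\<phi>. \<phi> v)"
  using assms dual_closed[OF _ assms]
  by (intro linear_mapI dual_space_is_vs base_field_is_vs module_homI)
    (simp_all add: dual_space_simps base_field_def)

lemma dual_eqI:
  assumes "\<phi> \<in> carrier (dual_space K V)" and "\<psi> \<in> carrier (dual_space K V)"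
    and "S \<subseteq> carrier V" and "span S = carrier V" and "\<And>s. s \<in> S \<Longrightarrow> \<phi> s = \<psi> s"
  shows "\<phi> = \<psi>"
proof (rule extensionalityI)
  show "\<phi> \<in> extensional (carrier V)" "\<psi> \<in> extensional (carrier V)"
    using assms(1,2) by (simp_all add: carrier_dual_space)
  have "linear_map K V (base_field K) \<phi>" "linear_map K V (base_field K) \<psi>"
    using assms(1,2) by (simp_all add: carrier_dual_space)
  from linear_map_eq_on_span[OF this assms(3,5)]
  show "\<phi> v = \<psi> v" if "v \<in> carrier V" for v
    using that assms(4) by simp
qed

lemma inclusion_linear:
  assumes "subspace K X V"
  shows "linear_map K (V\<lparr>carrier := X\<rparr>) V id"
  using submodule.subset[OF is_module[OF assms]]
  by (intro linear_mapI subspace_is_vs[OF assms] vectorspace_axioms module_homI) auto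

end

text \<open>Covers coboundaries and restrictions alike, a restriction being the adjoint of an
  inclusion.\<close>

lemma adjoint_linear:
  assumes "linear_map K V W f"
  shows "linear_map K (dual_space K W) (dual_space K V) (adjoint V f)"
proof -
  interpret linear_map K V W f by fact
  show ?thesis
  proof (intro linear_mapI V.dual_space_is_vs W.dual_space_is_vs module_homI)
    fix \<phi> assume \<phi>: "\<phi> \<in> carrier (dual_space K W)"
    then have "\<phi> \<circ> f \<in> module_hom K V (base_field K)"
      by (intro module_hom_comp[OF f_hom]) (simp add: dual_space_def)
    then have "adjoint V f \<phi> \<in> module_hom K V (base_field K)"
      by (rule module_hom_cong[OF V.vectorspace_axioms]) (simp add: adjoint_def compose_def)
    then show "adjoint V f \<phi> \<in> carrier (dual_space K V)"
      by (simp add: dual_space_def adjoint_def compose_extensional)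
  qed (auto simp: V.dual_space_simps W.dual_space_simps adjoint_def compose_def)
qed

section \<open>The dual of a sequence of formal cells\<close>

context formal_cells
begin

sublocale D: differential_space K V d
  by (intro differential_space.intro linear square_zero)

text \<open>The cells in reversed order, so that \<open>\<tau> i\<close> is dual to the cell with
  the same index and no index shift enters the computations.\<close>

definition \<rho> :: "nat \<Rightarrow> 'v" where
  "\<rho> i = \<sigma> (n + 1 - i)"

definition \<tau> :: "nat \<Rightarrow> 'v \<Rightarrow> 'k" where
  "\<tau> i = dual_basis K V n \<sigma> (n + 1 - i)"

definition functional :: "(nat \<Rightarrow> 'k) \<Rightarrow> 'v \<Rightarrow> 'k" where
  "functional = family_comb (dual_space K V) {1..n} \<tau>"

definition dual_coeffs :: "nat \<Rightarrow> nat \<Rightarrow> 'k" where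
  "dual_coeffs = boundary_coeffs K (dual_space K V) (adjoint V d) n \<tau>"

section \<open>Duality between \<open>\<tau>\<close> and the reversed cells\<close>

lemma cells_closed: "\<sigma> ` {1..n} \<subseteq> carrier V"
  and cells_generate: "module.span K V (\<sigma> ` {1..n}) = carrier V"
  using basis by (auto simp: D.V.basis_def)

lemma cell_closed: "i \<in> {1..n} \<Longrightarrow> \<sigma> i \<in> carrier V"
  using cells_closed by blast

lemma reversed_cells: "\<rho> ` {1..n} = \<sigma> ` {1..n}"
proof -
  have "\<rho> i \<in> \<sigma> ` {1..n}" if "i \<in> {1..n}" for i
    using that by (auto simp: \<rho>_def intro!: imageI)
  moreover have "\<sigma> i \<in> \<rho> ` {1..n}" if "i \<in> {1..n}" for i
    using that by (intro image_eqI[of _ _ "n + 1 - i"]) (auto simp: \<rho>_def)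
  ultimately show ?thesis
    by blast
qed

lemma reversed_cell_closed: "i \<in> {1..n} \<Longrightarrow> \<rho> i \<in> carrier V"
  using reversed_cells cells_closed by blast

lemma family_comb_cells_bij:
  "bij_betw (family_comb V {1..n} \<sigma>) (carrier (ring.func_space K {1..n})) (carrier V)"
  using cell_closed by (intro D.V.family_comb_bij inj basis) auto

lemma coordinate_cell:
  assumes "j \<in> {1..n}"
  shows "coordinate K V n \<sigma> i (\<sigma> j) = standard_cell K n j i"
proof -
  have "family_comb V {1..n} \<sigma> (standard_cell K n j) = \<sigma> j"
    using assms cell_closed by (intro D.V.family_comb_standard_cell) auto
  then show ?thesis
    using D.V.coordinate_family_comb[OF family_comb_cells_bij D.V.standard_cell_closed, of i j] by simp
qed

lemma dual_basis_closed:
  assumes "i \<in> {1..n}"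
  shows "dual_basis K V n \<sigma> i \<in> carrier (dual_space K V)"
proof -
  have "linear_map K V (base_field K) (coordinate K V n \<sigma> i)"
    using cell_closed assms by (intro D.V.coordinate_linear family_comb_cells_bij) auto
  then have "dual_basis K V n \<sigma> i \<in> module_hom K V (base_field K)"
    by (intro module_hom_cong[OF D.V.vectorspace_axioms linear_map_hom]) (simp_all add: dual_basis_def)
  then show ?thesis
    by (simp add: dual_space_def dual_basis_def)
qed

lemma \<tau>_closed: "\<tau> \<in> {1..n} \<rightarrow> carrier (dual_space K V)"
  unfolding \<tau>_def by (intro funcsetI dual_basis_closed) auto

lemma \<tau>_reversed_cell:
  assumes "i \<in> {1..n}" and "j \<in> {1..n}"
  shows "\<tau> i (\<rho> j) = (if i = j then \<one>\<^bsub>K\<^esub> else \<zero>\<^bsub>K\<^esub>)"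
proof -
  have "n + 1 - j \<in> {1..n}"
    using assms by auto
  then show ?thesis
    using assms reversed_cell_closed[OF assms(2)] coordinate_cell[of "n + 1 - j" "n + 1 - i"]
    by (auto simp: \<tau>_def dual_basis_def standard_cell_def \<rho>_def)
qed

lemma dual_eq_on_cells:
  assumes "\<phi> \<in> carrier (dual_space K V)" and "\<psi> \<in> carrier (dual_space K V)"
    and "\<And>i. i \<in> {1..n} \<Longrightarrow> \<phi> (\<rho> i) = \<psi> (\<rho> i)"
  shows "\<phi> = \<psi>"
  using assms(3) by (intro D.V.dual_eqI[OF assms(1,2) cells_closed cells_generate])
    (metis imageE reversed_cells)

lemma functional_closed: "x \<in> carrier (ring.func_space K {1..n}) \<Longrightarrow> functional x \<in> carrier (dual_space K V)"
  unfolding functional_def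
  by (rule linear_map.T_im[OF vectorspace.family_comb_linear[OF D.V.dual_space_is_vs \<tau>_closed]])

lemma functional_apply:
  assumes "x \<in> carrier (ring.func_space K {1..n})" and "v \<in> carrier V"
  shows "functional x v = (\<Oplus>\<^bsub>K\<^esub>j\<in>{1..n}. x j \<otimes>\<^bsub>K\<^esub> \<tau> j v)"
proof -
  interpret U: vectorspace K "dual_space K V"
    by (rule D.V.dual_space_is_vs)
  interpret ev: linear_map K "dual_space K V" "base_field K" "\<lambda>\<phi>. \<phi> v"
    by (rule D.V.dual_evaluation_linear[OF assms(2)])
  have x: "x j \<in> carrier K" if "j \<in> {1..n}" for j
    using assms(1) that by (auto simp: D.V.module.R.func_space_def)
  then have "functional x v = (\<Oplus>\<^bsub>base_field K\<^esub>j\<in>{1..n}. (x j \<odot>\<^bsub>dual_space K V\<^esub> \<tau> j) v)"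
    unfolding functional_def family_comb_def using \<tau>_closed by (intro ev.map_finsum) auto
  also have "\<dots> = (\<Oplus>\<^bsub>K\<^esub>j\<in>{1..n}. (x j \<odot>\<^bsub>dual_space K V\<^esub> \<tau> j) v)"
    by (rule D.V.finsum_base_field)
  also have "\<dots> = (\<Oplus>\<^bsub>K\<^esub>j\<in>{1..n}. x j \<otimes>\<^bsub>K\<^esub> \<tau> j v)"
    by (simp add: D.V.dual_space_simps assms(2))
  finally show ?thesis .
qed

text \<open>Evaluation on the reversed cells inverts \<open>functional\<close>; its injectivity and
  surjectivity both rest on this.\<close>

lemma functional_cell:
  assumes "x \<in> carrier (ring.func_space K {1..n})" and "i \<in> {1..n}"
  shows "functional x (\<rho> i) = x i"
proof -
  have x: "x j \<in> carrier K" if "j \<in> {1..n}" for j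
    using assms(1) that by (auto simp: D.V.module.R.func_space_def)
  have "functional x (\<rho> i) = (\<Oplus>\<^bsub>K\<^esub>j\<in>{1..n}. x j \<otimes>\<^bsub>K\<^esub> \<tau> j (\<rho> i))"
    by (rule functional_apply[OF assms(1) reversed_cell_closed[OF assms(2)]])
  also have "\<dots> = (\<Oplus>\<^bsub>K\<^esub>j\<in>{1..n}. if i = j then x j else \<zero>\<^bsub>K\<^esub>)"
    using x assms(2) by (intro D.V.module.R.finsum_cong') (auto simp: \<tau>_reversed_cell)
  also have "\<dots> = x i"
    using x assms(2) by (intro D.V.module.R.finsum_singleton) auto
  finally show ?thesis .
qed

lemma functional_coordinates:
  assumes "\<phi> \<in> carrier (dual_space K V)"
  shows "(\<lambda>i\<in>{1..n}. \<phi> (\<rho> i)) \<in> carrier (ring.func_space K {1..n})"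
    and "functional (\<lambda>i\<in>{1..n}. \<phi> (\<rho> i)) = \<phi>"
proof -
  show *: "(\<lambda>i\<in>{1..n}. \<phi> (\<rho> i)) \<in> carrier (ring.func_space K {1..n})"
    using assms by (auto simp: D.V.module.R.func_space_def intro!: D.V.dual_closed reversed_cell_closed)
  show "functional (\<lambda>i\<in>{1..n}. \<phi> (\<rho> i)) = \<phi>"
    by (rule dual_eq_on_cells[OF functional_closed[OF *] assms]) (subst functional_cell[OF *]; simp)
qed

lemma functional_inject:
  assumes "x \<in> carrier (ring.func_space K {1..n})" and "y \<in> carrier (ring.func_space K {1..n})"
    and "functional x = functional y"
  shows "x = y"
proof (rule extensionalityI[of _ "{1..n}"])
  show "x \<in> extensional {1..n}" "y \<in> extensional {1..n}"
    using assms(1,2) by (simp_all add: D.V.module.R.func_space_def PiE_def)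
  show "x i = y i" if "i \<in> {1..n}" for i
    using functional_cell[OF assms(1) that] functional_cell[OF assms(2) that] assms(3) by simp
qed

lemma functional_bij:
  "bij_betw functional (carrier (ring.func_space K {1..n})) (carrier (dual_space K V))"
  unfolding bij_betw_def
proof (intro conjI inj_onI equalityI subsetI)
  show "\<phi> \<in> functional ` carrier (ring.func_space K {1..n})" if "\<phi> \<in> carrier (dual_space K V)" for \<phi>
    using functional_coordinates[OF that] by (intro image_eqI[OF sym])
qed (use functional_inject functional_closed in blast)+

section \<open>The matrix of the coboundary in the dual basis\<close>

lemma coordinate_dual:
  assumes "\<phi> \<in> carrier (dual_space K V)" and "i \<in> {1..n}"
  shows "coordinate K (dual_space K V) n \<tau> i \<phi> = \<phi> (\<rho> i)"
  using vectorspace.coordinate_family_comb[OF D.V.dual_space_is_vs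
      functional_bij[unfolded functional_def] functional_coordinates(1)[OF assms(1)], of i]
    functional_coordinates(2)[OF assms(1)] assms(2)
  by (simp add: functional_def)

lemma coboundary_closed:
  "\<phi> \<in> carrier (dual_space K V) \<Longrightarrow> adjoint V d \<phi> \<in> carrier (dual_space K V)"
  by (rule linear_map.T_im[OF adjoint_linear[OF linear]])

text \<open>Coordinates with respect to \<open>\<tau>\<close> are values on the reversed cells. The
  entry is thus the coefficient of \<open>\<rho> j\<close> in \<open>d (\<rho> i)\<close>: the
  matrix of \<open>d\<close> reflected in its antidiagonal.\<close>

lemma dual_coeffs_eq:
  assumes "i \<in> {1..n}" and "j \<in> {1..n}"
  shows "dual_coeffs i j = \<tau> j (d (\<rho> i))"
  using coordinate_dual[OF coboundary_closed assms(1), of "\<tau> j"] \<tau>_closed assms(2)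
    reversed_cell_closed[OF assms(1)]
  by (simp add: dual_coeffs_def boundary_coeffs_def adjoint_def compose_def Pi_iff)

lemma dual_coeffs_closed:
  assumes "i \<in> {1..n}" and "j \<in> {1..n}"
  shows "dual_coeffs i j \<in> carrier K"
  unfolding dual_coeffs_eq[OF assms]
  using assms \<tau>_closed by (intro D.V.dual_closed D.T_im reversed_cell_closed) auto

lemma matrix_map_dual_coeffs_linear:
  "linear_map K (ring.func_space K {1..n}) (ring.func_space K {1..n}) (matrix_map K n dual_coeffs)"
  by (intro D.V.matrix_map_linear dual_coeffs_closed)

text \<open>Functionals are determined by their values on the cells, so the chain map property
  reduces to comparing the two sides on each \<open>\<rho> i\<close>.\<close>

lemma functional_matrix_map:
  assumes "x \<in> carrier (ring.func_space K {1..n})"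
  shows "functional (matrix_map K n dual_coeffs x) = adjoint V d (functional x)"
proof (rule dual_eq_on_cells)
  have M: "matrix_map K n dual_coeffs x \<in> carrier (ring.func_space K {1..n})"
    by (rule linear_map.T_im[OF matrix_map_dual_coeffs_linear assms])
  show "functional (matrix_map K n dual_coeffs x) \<in> carrier (dual_space K V)"
    by (rule functional_closed[OF M])
  show "adjoint V d (functional x) \<in> carrier (dual_space K V)"
    by (intro coboundary_closed functional_closed assms)
  fix i assume i: "i \<in> {1..n}"
  have x: "x j \<in> carrier K" if "j \<in> {1..n}" for j
    using assms that by (auto simp: D.V.module.R.func_space_def)
  have \<rho>: "\<rho> i \<in> carrier V"
    by (rule reversed_cell_closed[OF i])
  have "functional (matrix_map K n dual_coeffs x) (\<rho> i)
      = (\<Oplus>\<^bsub>K\<^esub>j\<in>{1..n}. dual_coeffs i j \<otimes>\<^bsub>K\<^esub> x j)"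
    using i by (simp only: functional_cell[OF M i]) (simp add: matrix_map_def)
  also have "\<dots> = (\<Oplus>\<^bsub>K\<^esub>j\<in>{1..n}. x j \<otimes>\<^bsub>K\<^esub> \<tau> j (d (\<rho> i)))"
    using x i dual_coeffs_closed[OF i]
    by (intro D.V.module.R.finsum_cong') (auto simp: dual_coeffs_eq[symmetric] D.V.module.R.m_comm)
  also have "\<dots> = functional x (d (\<rho> i))"
    using \<rho> by (subst functional_apply[OF assms]) auto
  also have "\<dots> = adjoint V d (functional x) (\<rho> i)"
    using \<rho> by (simp add: adjoint_def compose_def)
  finally show "functional (matrix_map K n dual_coeffs x) (\<rho> i)
      = adjoint V d (functional x) (\<rho> i)" .
qed

lemma functional_linear:
  "linear_map K (ring.func_space K {1..n}) (dual_space K V) functional"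
  unfolding functional_def
  by (rule vectorspace.family_comb_linear[OF D.V.dual_space_is_vs \<tau>_closed])

lemma coboundary_square_zero:
  assumes "\<phi> \<in> carrier (dual_space K V)"
  shows "adjoint V d (adjoint V d \<phi>) = \<zero>\<^bsub>dual_space K V\<^esub>"
proof -
  interpret \<phi>: linear_map K V "base_field K" \<phi>
    using assms D.V.carrier_dual_space by blast
  have "\<phi> \<zero>\<^bsub>V\<^esub> = \<zero>\<^bsub>K\<^esub>"
    using \<phi>.T0_is_0 by (simp add: base_field_def)
  then show ?thesis
    by (auto simp: adjoint_def compose_def D.V.dual_space_simps square_zero)
qed

text \<open>Phrased for the coordinates of an arbitrary coboundary because it is applied both to
  columns of the matrix and to values of the matrix map. The identity is pulled back from cochains
  through the injective \<open>functional\<close>.\<close>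

lemma matrix_map_square_zero:
  assumes "x \<in> carrier (ring.func_space K {1..n})"
    and "functional x = adjoint V d \<phi>" and "\<phi> \<in> carrier (dual_space K V)"
  shows "matrix_map K n dual_coeffs x = \<zero>\<^bsub>ring.func_space K {1..n}\<^esub>"
proof (rule functional_inject)
  interpret M: linear_map K "ring.func_space K {1..n}" "ring.func_space K {1..n}" "matrix_map K n dual_coeffs"
    by (rule matrix_map_dual_coeffs_linear)
  show "matrix_map K n dual_coeffs x \<in> carrier (ring.func_space K {1..n})"
    by (rule M.T_im[OF assms(1)])
  show "\<zero>\<^bsub>ring.func_space K {1..n}\<^esub> \<in> carrier (ring.func_space K {1..n})"
    by (rule M.V.module.M.zero_closed)
  show "functional (matrix_map K n dual_coeffs x) = functional \<zero>\<^bsub>ring.func_space K {1..n}\<^esub>"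
    using functional_matrix_map[OF assms(1)] coboundary_square_zero[OF assms(3)] assms(2)
      linear_map.T0_is_0[OF functional_linear] by simp
qed

lemma dual_coeffs_upper_triangular:
  assumes "i \<in> {1..n}" and "j \<in> {1..n}" and "j \<le> i"
  shows "dual_coeffs i j = \<zero>\<^bsub>K\<^esub>"
proof -
  have "linear_map K V (base_field K) (\<tau> j)"
    using \<tau>_closed assms(2) D.V.carrier_dual_space by blast
  moreover have "linear_map K V (base_field K) (\<lambda>_. \<zero>\<^bsub>K\<^esub>)"
    by (intro linear_mapI D.V.vectorspace_axioms D.V.base_field_is_vs module_homI)
      (simp_all add: base_field_def)
  moreover have "\<sigma> ` {1..<n + 1 - i} \<subseteq> carrier V"
    using assms(1) by (intro image_subsetI cell_closed) auto
  moreover have "\<tau> j s = \<zero>\<^bsub>K\<^esub>" if s: "s \<in> \<sigma> ` {1..<n + 1 - i}" for s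
  proof -
    obtain k where k: "k \<in> {1..<n + 1 - i}" "s = \<sigma> k"
      using s by blast
    \<comment> \<open>Reversal turns \<open>k < n + 1 - i\<close> into an index above
      \<open>i\<close>, hence above \<open>j\<close>, and \<open>\<tau> j\<close> vanishes on all
      those cells.\<close>
    then have "s = \<rho> (n + 1 - k)" "n + 1 - k \<in> {1..n}" "j \<noteq> n + 1 - k"
      using assms by (auto simp: \<rho>_def)
    then show ?thesis
      using \<tau>_reversed_cell[OF assms(2)] by simp
  qed
  moreover have "d (\<rho> i) \<in> module.span K V (\<sigma> ` {1..<n + 1 - i})"
    unfolding \<rho>_def using assms(1) by (intro boundary) auto
  ultimately show ?thesis
    unfolding dual_coeffs_eq[OF assms(1,2)] by (rule linear_map_eq_on_span)
qed

lemma boundary_matrix_dual_coeffs: "boundary_matrix K n dual_coeffs"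
  unfolding boundary_matrix_def
proof (intro conjI ballI impI dual_coeffs_closed dual_coeffs_upper_triangular)
  fix i j assume i: "i \<in> {1..n}" and j: "j \<in> {1..n}"
  \<comment> \<open>\<open>x\<close> is column \<open>j\<close> of the matrix, seen as the
    coordinates of the coboundary of \<open>\<tau> j\<close>; applying the matrix to it yields
    column \<open>j\<close> of the square.\<close>
  define x where "x = (\<lambda>k\<in>{1..n}. adjoint V d (\<tau> j) (\<rho> k))"
  have \<tau>: "\<tau> j \<in> carrier (dual_space K V)"
    using \<tau>_closed j by blast
  have x: "x k = dual_coeffs k j" if "k \<in> {1..n}" for k
    using that dual_coeffs_eq[OF that j] reversed_cell_closed[OF that]
    by (simp add: x_def adjoint_def compose_def)
  have "matrix_map K n dual_coeffs x = \<zero>\<^bsub>ring.func_space K {1..n}\<^esub>"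
    unfolding x_def
    by (rule matrix_map_square_zero[OF functional_coordinates(1)[OF coboundary_closed[OF \<tau>]]
          functional_coordinates(2)[OF coboundary_closed[OF \<tau>]] \<tau>])
  then have "(\<Oplus>\<^bsub>K\<^esub>k\<in>{1..n}. dual_coeffs i k \<otimes>\<^bsub>K\<^esub> x k) = \<zero>\<^bsub>K\<^esub>"
    using i by (auto simp: matrix_map_def D.V.module.R.func_space_def fun_eq_iff restrict_def split: if_splits)
  moreover have "(\<Oplus>\<^bsub>K\<^esub>k\<in>{1..n}. dual_coeffs i k \<otimes>\<^bsub>K\<^esub> x k)
      = (\<Oplus>\<^bsub>K\<^esub>k\<in>{1..n}. dual_coeffs i k \<otimes>\<^bsub>K\<^esub> dual_coeffs k j)"
    using i j dual_coeffs_closed by (intro D.V.module.R.finsum_cong') (auto simp: x)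
  ultimately show "(\<Oplus>\<^bsub>K\<^esub>k\<in>{1..n}. dual_coeffs i k \<otimes>\<^bsub>K\<^esub> dual_coeffs k j) = \<zero>\<^bsub>K\<^esub>"
    by simp
qed

lemma matrix_map_differential:
  "differential_space K (ring.func_space K {1..n}) (matrix_map K n dual_coeffs)"
proof (intro differential_space.intro matrix_map_dual_coeffs_linear)
  fix x assume x: "x \<in> carrier (ring.func_space K {1..n})"
  show "matrix_map K n dual_coeffs (matrix_map K n dual_coeffs x) = \<zero>\<^bsub>ring.func_space K {1..n}\<^esub>"
    by (rule matrix_map_square_zero[OF linear_map.T_im[OF matrix_map_dual_coeffs_linear x]
          functional_matrix_map[OF x] functional_closed[OF x]])
qed

section \<open>Restriction of functionals to the steps of the filtration\<close>

abbreviation subcomplex :: "nat \<Rightarrow> ('k, 'v, 'm) module_scheme" where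
  "subcomplex i \<equiv> V\<lparr>carrier := filtration K V \<sigma> i\<rparr>"

lemma subcells_closed: "i \<le> n \<Longrightarrow> \<sigma> ` {1..i} \<subseteq> carrier V"
  using cell_closed by (intro image_subsetI) simp

lemma filtration_subspace: "i \<le> n \<Longrightarrow> subspace K (filtration K V \<sigma> i) V"
  unfolding filtration_def by (intro D.V.span_is_subspace subcells_closed)

lemma subcomplex_vs: "i \<le> n \<Longrightarrow> vectorspace K (subcomplex i)"
  by (intro D.V.subspace_is_vs filtration_subspace)

lemma filtration_mono: "i \<le> j \<Longrightarrow> filtration K V \<sigma> i \<subseteq> filtration K V \<sigma> j"
  unfolding filtration_def by (intro D.V.module.span_is_monotone image_mono) auto

lemma subcells_in_filtration: "i \<le> n \<Longrightarrow> \<sigma> ` {1..i} \<subseteq> filtration K V \<sigma> i"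
  unfolding filtration_def by (intro D.V.module.in_own_span subcells_closed)

lemma filtration_closed: "i \<le> n \<Longrightarrow> v \<in> filtration K V \<sigma> i \<Longrightarrow> v \<in> carrier V"
  using submodule.subset[OF D.V.is_module[OF filtration_subspace]] by blast

lemma filtration_invariant:
  assumes "i \<le> n" and "v \<in> filtration K V \<sigma> i"
  shows "d v \<in> filtration K V \<sigma> i"
proof -
  interpret S: submodule K "filtration K V \<sigma> i" V
    by (intro D.V.is_module filtration_subspace assms(1))
  \<comment> \<open>The preimage of the step under \<open>d\<close> is a subspace, so only the
    generating cells have to be checked.\<close>
  have "submodule K {v \<in> carrier V. d v \<in> filtration K V \<sigma> i} V"
    by unfold_locales (auto intro: S.m_closed S.smult_closed)
  moreover have "d (\<sigma> j) \<in> filtration K V \<sigma> i" if "j \<in> {1..i}" for j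
  proof -
    have "d (\<sigma> j) \<in> module.span K V (\<sigma> ` {1..<j})"
      using that assms(1) by (intro boundary) auto
    moreover have "module.span K V (\<sigma> ` {1..<j}) \<subseteq> module.span K V (\<sigma> ` {1..i})"
      using that by (intro D.V.module.span_is_monotone image_mono) auto
    ultimately show ?thesis
      unfolding filtration_def by blast
  qed
  ultimately have "filtration K V \<sigma> i \<subseteq> {v \<in> carrier V. d v \<in> filtration K V \<sigma> i}"
    using subcells_closed[OF assms(1)] unfolding filtration_def[of K V \<sigma> i]
    by (intro D.V.module.span_is_subset) blast+
  then show ?thesis
    using assms(2) by blast
qed

text \<open>The condition \<open>i < j\<close> amounts to
  \<open>n + 1 - j \<le> n - i\<close>.\<close>

lemma reversed_cell_filtration:
  assumes "i < n" and "j \<in> {i<..n}"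
  shows "\<rho> j \<in> filtration K V \<sigma> (n - i)"
  unfolding \<rho>_def using assms
  by (intro subsetD[OF subcells_in_filtration] imageI) auto

lemma dual_subcomplex_eqI:
  assumes "i < n" and "\<phi> \<in> carrier (dual_space K (subcomplex (n - i)))"
    and "\<psi> \<in> carrier (dual_space K (subcomplex (n - i)))"
    and "\<And>j. j \<in> {i<..n} \<Longrightarrow> \<phi> (\<rho> j) = \<psi> (\<rho> j)"
  shows "\<phi> = \<psi>"
proof (rule vectorspace.dual_eqI[OF subcomplex_vs assms(2,3)])
  show "\<sigma> ` {1..n - i} \<subseteq> carrier (subcomplex (n - i))"
    using subcells_in_filtration[of "n - i"] by simp
  \<comment> \<open>A span does not change when it is formed inside a subspace that contains its
    generators.\<close>
  show "module.span K (subcomplex (n - i)) (\<sigma> ` {1..n - i}) = carrier (subcomplex (n - i))"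
    using D.V.module.span_li_not_depend(1)[OF subcells_in_filtration
        D.V.is_module[OF filtration_subspace], of "n - i"]
    by (simp add: filtration_def)
  show "\<phi> s = \<psi> s" if s: "s \<in> \<sigma> ` {1..n - i}" for s
  proof -
    obtain k where k: "k \<in> {1..n - i}" "s = \<sigma> k"
      using s by blast
    then have "s = \<rho> (n + 1 - k)" "n + 1 - k \<in> {i<..n}"
      using assms(1) by (auto simp: \<rho>_def)
    then show ?thesis
      using assms(4) by simp
  qed
qed simp

definition subfunctional :: "nat \<Rightarrow> (nat \<Rightarrow> 'k) \<Rightarrow> 'v \<Rightarrow> 'k" where
  "subfunctional i = adjoint (subcomplex (n - i)) id \<circ> functional"

lemma subfunctional_apply:
  "subfunctional i x v = (if v \<in> filtration K V \<sigma> (n - i) then functional x v else undefined)"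
  by (simp add: subfunctional_def adjoint_def compose_def)

lemma subfunctional_linear:
  "linear_map K (ring.func_space K {1..n}) (dual_space K (subcomplex (n - i))) (subfunctional i)"
  unfolding subfunctional_def
  by (intro linear_map_comp[OF functional_linear] adjoint_linear D.V.inclusion_linear
      filtration_subspace) simp

lemma subfunctional_reversed_cell:
  assumes "i < n" and "x \<in> carrier (ring.func_space K {1..n})" and "j \<in> {i<..n}"
  shows "subfunctional i x (\<rho> j) = x j"
  using reversed_cell_filtration[OF assms(1,3)] functional_cell[OF assms(2), of j] assms(3)
  by (auto simp: subfunctional_apply)

lemma subfunctional_surj:
  assumes "i < n"
  shows "subfunctional i ` carrier (ring.func_space K {1..n}) = carrier (dual_space K (subcomplex (n - i)))"
proof (intro equalityI image_subsetI subsetI)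
  show "subfunctional i x \<in> carrier (dual_space K (subcomplex (n - i)))"
    if "x \<in> carrier (ring.func_space K {1..n})" for x
    by (rule linear_map.T_im[OF subfunctional_linear that])
  fix \<phi> assume \<phi>: "\<phi> \<in> carrier (dual_space K (subcomplex (n - i)))"
  \<comment> \<open>Extension by zero: the cells outside the subcomplex are the
    \<open>\<rho> j\<close> with \<open>j \<le> i\<close>.\<close>
  define x where "x = (\<lambda>j\<in>{1..n}. if i < j then \<phi> (\<rho> j) else \<zero>\<^bsub>K\<^esub>)"
  have "\<phi> (\<rho> j) \<in> carrier K" if "j \<in> {i<..n}" for j
    using vectorspace.dual_closed[OF subcomplex_vs \<phi>] reversed_cell_filtration[OF assms that] by simp
  then have x: "x \<in> carrier (ring.func_space K {1..n})"
    by (auto simp: x_def D.V.module.R.func_space_def)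
  have "subfunctional i x = \<phi>"
  proof (rule dual_subcomplex_eqI[OF assms linear_map.T_im[OF subfunctional_linear x] \<phi>])
    show "subfunctional i x (\<rho> j) = \<phi> (\<rho> j)" if "j \<in> {i<..n}" for j
      using subfunctional_reversed_cell[OF assms x that] that by (auto simp: x_def)
  qed
  then show "\<phi> \<in> subfunctional i ` carrier (ring.func_space K {1..n})"
    using x by blast
qed

text \<open>Both sides say that the coordinates above \<open>i\<close> vanish: on the left these are
  the values on the cells of the subcomplex, on the right they are the ones not spanned by the first
  \<open>i\<close> standard cells.\<close>

lemma subfunctional_kernel:
  assumes "i < n"
  shows "mod_hom.ker (ring.func_space K {1..n}) (dual_space K (subcomplex (n - i))) (subfunctional i)
    = filtration K (ring.func_space K {1..n}) (standard_cell K n) i"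
proof -
  interpret f: linear_map K "ring.func_space K {1..n}" "dual_space K (subcomplex (n - i))" "subfunctional i"
    by (rule subfunctional_linear)
  have zero: "\<zero>\<^bsub>dual_space K (subcomplex (n - i))\<^esub> (\<rho> j) = \<zero>\<^bsub>K\<^esub>" if "j \<in> {i<..n}" for j
    using vectorspace.dual_space_simps(3)[OF subcomplex_vs[of "n - i"]]
      reversed_cell_filtration[OF assms that] by simp
  have "subfunctional i x = \<zero>\<^bsub>dual_space K (subcomplex (n - i))\<^esub> \<longleftrightarrow> (\<forall>j\<in>{i<..n}. x j = \<zero>\<^bsub>K\<^esub>)"
    if x: "x \<in> carrier (ring.func_space K {1..n})" for x
  proof
    assume "subfunctional i x = \<zero>\<^bsub>dual_space K (subcomplex (n - i))\<^esub>"
    then show "\<forall>j\<in>{i<..n}. x j = \<zero>\<^bsub>K\<^esub>"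
      using subfunctional_reversed_cell[OF assms x] zero by metis
  next
    assume "\<forall>j\<in>{i<..n}. x j = \<zero>\<^bsub>K\<^esub>"
    then show "subfunctional i x = \<zero>\<^bsub>dual_space K (subcomplex (n - i))\<^esub>"
      using subfunctional_reversed_cell[OF assms x] zero
      by (intro dual_subcomplex_eqI[OF assms f.T_im[OF x] f.W.module.M.zero_closed]) simp
  qed
  moreover have "filtration K (ring.func_space K {1..n}) (standard_cell K n) i
      = {x \<in> carrier (ring.func_space K {1..n}). \<forall>j\<in>{i<..n}. x j = \<zero>\<^bsub>K\<^esub>}"
    unfolding filtration_def using vectorspace.axioms(2)[OF D.V.vectorspace_axioms] less_imp_le[OF assms]
    by (rule span_standard_cells)
  ultimately show ?thesis
    unfolding f.ker_def by blast
qed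

lemma subfunctional_commutes:
  assumes "x \<in> carrier (ring.func_space K {1..n})"
  shows "subfunctional i (matrix_map K n dual_coeffs x) = adjoint (subcomplex (n - i)) d (subfunctional i x)"
proof
  fix v
  show "subfunctional i (matrix_map K n dual_coeffs x) v
      = adjoint (subcomplex (n - i)) d (subfunctional i x) v"
  proof (cases "v \<in> filtration K V \<sigma> (n - i)")
    case True
    \<comment> \<open>Restriction commutes with the coboundary because \<open>d\<close> preserves
      the step; off the step both sides are \<open>undefined\<close>.\<close>
    then have "v \<in> carrier V" "d v \<in> filtration K V \<sigma> (n - i)"
      using filtration_closed[of "n - i"] filtration_invariant[of "n - i"] by auto
    with True show ?thesis
      by (simp add: subfunctional_apply functional_matrix_map[OF assms] adjoint_def compose_def)
  qed (simp add: subfunctional_apply adjoint_def compose_def)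
qed

text \<open>Restricting in two stages equals restricting at once, as the smaller step lies in the
  larger one.\<close>

lemma subfunctional_restrict:
  "adjoint (subcomplex (n - Suc i)) id (subfunctional i x) = subfunctional (Suc i) x"
  using filtration_mono[OF diff_le_mono2[OF le_SucI[OF order.refl]], of n i]
  by (auto simp: fun_eq_iff subfunctional_apply adjoint_def compose_def)

lemma persistent_cohomology_iso:
  "pmodule_iso K n
     (persistent_relative_homology K (ring.func_space K {1..n}) (matrix_map K n dual_coeffs)
       (standard_cell K n))
     (reverse_index n (persistent_cohomology K V d \<sigma>))"
proof -
  \<comment> \<open>The map at index \<open>i\<close> goes from the cochains of step
    \<open>n - i\<close> to those of step \<open>n - Suc i\<close>. Maps of the cohomology sequence
    carry the index of their target, hence \<open>n - Suc i\<close>.\<close>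
  have "reverse_index n (persistent_cohomology K V d \<sigma>)
    = \<lparr>pspace = \<lambda>i. homology (dual_space K (subcomplex (n - i))) (adjoint (subcomplex (n - i)) d),
       pmap = \<lambda>i. homology_map (dual_space K (subcomplex (n - Suc i)))
         (adjoint (subcomplex (n - Suc i)) d) (adjoint (subcomplex (n - Suc i)) id)\<rparr>"
    by (simp add: reverse_index_def persistent_cohomology_def Let_def)
  moreover have "pmodule_iso K n
      (persistent_relative_homology K (ring.func_space K {1..n}) (matrix_map K n dual_coeffs)
        (standard_cell K n)) \<dots>"
    by (rule persistent_relative_homology_iso[where f = subfunctional])
      (rule matrix_map_differential subfunctional_linear subfunctional_surj subfunctional_kernel
        subfunctional_commutes subfunctional_restrict | assumption)+
  ultimately show ?thesis
    by (simp only:)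
qed

end

theorem corollary2p9:
  fixes K :: "('k, 'r) ring_scheme"
    and alg :: "nat \<Rightarrow> (nat \<Rightarrow> nat \<Rightarrow> 'k) \<Rightarrow> ('k, 'o) space_sequence"
    and C :: "('k, 'c, 'm) module_scheme"
    and d :: "'c \<Rightarrow> 'c"
    and n :: nat
    and \<sigma> :: "nat \<Rightarrow> 'c"
  assumes "field K"
    and "computes_relative_homology K alg"
    and "formal_cells K C d n \<sigma>"
  shows "let \<tau> = (\<lambda>i. dual_basis K C n \<sigma> (n + 1 - i));
             \<delta> = adjoint C d
         in pmodule_iso K n
              (alg n (boundary_coeffs K (dual_space K C) \<delta> n \<tau>))
              (reverse_index n (persistent_cohomology K C d \<sigma>))"
proof -
  interpret formal_cells K C d n \<sigma> by fact
  have "\<tau> = (\<lambda>i. dual_basis K C n \<sigma> (n + 1 - i))"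
    by (simp add: fun_eq_iff \<tau>_def)
  then have coeffs: "dual_coeffs
      = boundary_coeffs K (dual_space K C) (adjoint C d) n (\<lambda>i. dual_basis K C n \<sigma> (n + 1 - i))"
    by (simp only: dual_coeffs_def)
  \<comment> \<open>The guarantee on the algorithm becomes available because
    \<open>dual_coeffs\<close> is an admissible boundary matrix.\<close>
  have "pmodule_iso K n (alg n dual_coeffs)
      (persistent_relative_homology K (ring.func_space K {1..n}) (matrix_map K n dual_coeffs)
        (standard_cell K n))"
    using assms(2) nonempty boundary_matrix_dual_coeffs
    unfolding computes_relative_homology_def by blast
  then have "pmodule_iso K n (alg n dual_coeffs) (reverse_index n (persistent_cohomology K C d \<sigma>))"
    by (rule pmodule_iso_trans[OF _ persistent_cohomology_iso])
  then show ?thesis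
    unfolding Let_def coeffs .
qed

end
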